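(* Let $S=\mathbf{k}[x_1,\dots,x_n]$ over a field $\mathbf{k}$, and let $I\subset S$ be a monomial ideal of codimension $c$ minimally generated by monomials $\mu_1,\mu_2,\dots,\mu_r$, where $\mu_i$ has degree $2$ for all $2\le i\le r$. Then $S/I$ satisfies the Taylor upper bound conjecture, that is, $$e(S/I)\le\frac1{c!}\prod_{i=1}^c\tilde M_i(S/I).$$
   Context: $S$ is standard graded, $I$ is proper, and $e(S/I)$ is the multiplicity of $S/I$. $\mathrm{GEN}(I)=\{\mu_1,\dots,\mu_r\}$ is the set of minimal monomial generators, and $\tilde M_i(S/I)=\max\{\deg\operatorname{lcm}(T):T\subset\mathrm{GEN}(I),|T|=i\}$ is the $i$-th maximal shift of the Taylor resolution of $S/I$. *)

theory Defs
  imports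
    Complex_Main
    "HOL-Library.Poly_Mapping"
    "HOL-Library.Extended_Nat"
    "HOL-Computational_Algebra.Polynomial"
    "HOL-Algebra.Algebraic_Closure_Type"
begin

text \<open>
  A monomial in the variables \<open>'x\<close> is represented by its exponent vector. The polynomial ring
  over \<open>'k\<close> in \<open>n = CARD('x)\<close> variables consists of the finitely supported functions from
  exponent vectors to coefficients, with the
  convolution product of \<open>Poly_Mapping\<close>.
\<close>

type_synonym 'x expo = "'x \<Rightarrow>\<^sub>0 nat"
type_synonym ('x, 'k) mpoly = "'x expo \<Rightarrow>\<^sub>0 'k"

abbreviation S_ring :: "('x, 'k::field) mpoly ring"
  where "S_ring \<equiv> ring_of_type_algebra"

definition monomial :: "'x expo \<Rightarrow> ('x, 'k::field) mpoly"
  where "monomial m = Poly_Mapping.single m 1"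

definition mdeg :: "'x::finite expo \<Rightarrow> nat"
  where "mdeg m = (\<Sum>x\<in>UNIV. poly_mapping.lookup m x)"

definition monomial_ideal :: "('x, 'k::field) mpoly set \<Rightarrow> bool"
  where "monomial_ideal I \<longleftrightarrow> (\<exists>A. I = Idl\<^bsub>S_ring\<^esub> (monomial ` A))"

definition GEN :: "('x, 'k::field) mpoly set \<Rightarrow> 'x expo set"
  where "GEN I = {m. monomial m \<in> I \<and>
    (\<forall>m'. monomial m' \<in> I \<and> monomial m' dvd (monomial m :: ('x, 'k) mpoly) \<longrightarrow> m' = m)}"

text \<open>The element \<open>0\<close> is inserted so that the lcm of the empty set is the monomial \<open>1\<close>.\<close>

definition lcm_expo :: "'x::finite expo set \<Rightarrow> 'x expo"
  where "lcm_expo T = Abs_poly_mapping (\<lambda>x. Max (insert 0 ((\<lambda>m. poly_mapping.lookup m x) ` T)))"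

definition taylor_shift :: "('x::finite, 'k::field) mpoly set \<Rightarrow> nat \<Rightarrow> nat"
  where "taylor_shift I i = Max {mdeg (lcm_expo T) | T. T \<subseteq> GEN I \<and> finite T \<and> card T = i}"

definition prime_height :: "('a, 'b) ring_scheme \<Rightarrow> 'a set \<Rightarrow> enat"
  where "prime_height R P = Sup {enat h | h. \<exists>p :: nat \<Rightarrow> 'a set.
    (\<forall>i\<le>h. primeideal (p i) R) \<and> (\<forall>i<h. p i \<subset> p (Suc i)) \<and> p h = P}"

definition codim :: "('a, 'b) ring_scheme \<Rightarrow> 'a set \<Rightarrow> enat"
  where "codim R I = Inf {prime_height R P | P. primeideal P R \<and> I \<subseteq> P}"

text \<open>
  For a set \<open>V\<close> of polynomials, \<open>quot_dim I V\<close> is the dimension of the image of \<open>V\<close> in \<open>S/I\<close>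
  over the image of the constants, which for proper \<open>I\<close> is a copy of the ground field.
\<close>

definition quot_dim :: "('x, 'k::field) mpoly set \<Rightarrow> ('x, 'k) mpoly set \<Rightarrow> nat"
  where "quot_dim I V =
    ring.dim (S_ring Quot I)
      ((\<lambda>f. I +>\<^bsub>S_ring\<^esub> f) ` range (\<lambda>a. Poly_Mapping.single 0 a))
      ((\<lambda>f. I +>\<^bsub>S_ring\<^esub> f) ` V)"

definition hilbert_fun :: "('x::finite, 'k::field) mpoly set \<Rightarrow> nat \<Rightarrow> nat"
  where "hilbert_fun I d = quot_dim I {f. \<forall>m\<in>Poly_Mapping.keys f. mdeg m = d}"

definition hilbert_poly :: "('x::finite, 'k::field) mpoly set \<Rightarrow> real poly"
  where "hilbert_poly I =
    (THE P. eventually (\<lambda>d. real (hilbert_fun I d) = Polynomial.poly P (real d)) sequentially)"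

text \<open>
  If \<open>S/I\<close> has positive Krull dimension \<open>\<delta>\<close>, its Hilbert polynomial is nonzero of degree \<open>\<delta> - 1\<close>,
  and the multiplicity is \<open>(\<delta> - 1)!\<close> times the leading coefficient. If the dimension is \<open>0\<close>, the
  Hilbert polynomial vanishes and the multiplicity is the length of \<open>S/I\<close>, i.e. its
  dimension over the ground field.
\<close>

definition hs_multiplicity :: "('x::finite, 'k::field) mpoly set \<Rightarrow> real"
  where "hs_multiplicity I =
    (if hilbert_poly I = 0 then real (quot_dim I UNIV)
     else fact (Polynomial.degree (hilbert_poly I)) * Polynomial.lead_coeff (hilbert_poly I))"

end

theory Submission
  imports Defs
begin

text \<open>
Write a monomial as the set of cells below it: the monomial with exponent vector \<open>m\<close> becomes the
set of pairs \<open>(x, j)\<close> with \<open>j < m x\<close>. This is polarization. The minimal generators of \<open>I\<close> become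
the edges of a hypergraph \<open>H\<close> on the vertex set \<open>'x \<times> nat\<close>, an lcm becomes a union, and so the
\<open>i\<close>-th Taylor shift is the largest number \<open>M i\<close> of vertices covered by \<open>i\<close> edges. The codimension
\<open>c\<close> is the least size of a hitting set of \<open>H\<close>, and the multiplicity is at most the number of
hitting sets of size \<open>c\<close>. The theorem thus follows from a statement about hypergraphs with
at most one edge of size other than two: \<open>c!\<close> times the number \<open>N\<close> of minimum hitting sets is at
most \<open>M 1 * ... * M c\<close> (\<open>min_hitting_bound\<close>).

That inequality is an induction on \<open>c\<close>. Let \<open>W\<close> be the union of all minimum hitting sets. Counting
pairs of a vertex and a minimum hitting set containing it gives \<open>c * N\<close> as the sum over \<open>v \<in> W\<close> of
the number of minimum hitting sets through \<open>v\<close>, and these correspond to hitting sets of size \<open>c - 1\<close>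
of the edges that avoid \<open>v\<close>. Hence it suffices that \<open>W\<close> has at most \<open>M c\<close> elements, that is, that
some \<open>c\<close> edges cover \<open>W\<close> (\<open>union_min_hitting_covered\<close>). For a graph with a minimum cover \<open>D\<close>, the
set \<open>W - D\<close> can be matched into \<open>D\<close> along edges: a minimal set \<open>A\<close> violating Hall's condition would
avoid every minimum cover, because otherwise exchanging part of the cover for the neighbours of \<open>A\<close>
would make it smaller. The matching edges, completed by one private edge for each unmatched vertex of
\<open>D\<close>, are \<open>c\<close> edges that cover \<open>W\<close>. A single edge \<open>B\<close> of another size either leaves the covering
number of the graph of the other edges unchanged, and then the graph case suffices, or raises it by one; then \<open>B\<close>
is itself one of the \<open>c\<close> edges and the exchange argument is applied after deleting a vertex of \<open>B\<close>.

Two algebraic facts connect this with the definitions. First, the codimension is the least size of a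
set of variables meeting the support of every generator. A prime containing \<open>I\<close> contains such a set
of variables, and its height is at least their number. Conversely, an ideal generated by \<open>t\<close> variables
has height at most \<open>t\<close>: if the polynomials in a set \<open>U\<close> of variables meet a prime \<open>q\<close> only in \<open>0\<close>,
and \<open>p\<close> is a smaller prime, then some variable can be added to \<open>U\<close> so that the same holds for \<open>p\<close>.
So independent sets grow along a descending chain (\<open>independent_extends_below\<close>). Second, truncating
exponents at a bound \<open>K\<close> above all exponents of generators splits the monomials outside \<open>I\<close> into
finitely many translated orthants. Counting each in degree \<open>d\<close> gives the Hilbert polynomial; its
leading term counts the orthants of the largest dimension, and each of these yields a minimum hitting
set, namely the pairs \<open>(x, t x)\<close> for the coordinates below \<open>K\<close>.
\<close>

section \<open>Minimum hitting sets\<close>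

definition hits :: "'a set \<Rightarrow> 'a set set \<Rightarrow> bool"
  where "hits C H \<longleftrightarrow> (\<forall>e\<in>H. C \<inter> e \<noteq> {})"

text \<open>
For a polarized monomial ideal this is the \<open>i\<close>-th maximal shift of the Taylor resolution. The value
is meaningful only if \<open>H\<close> has at least \<open>i\<close> edges.
\<close>

definition max_union :: "'a set set \<Rightarrow> nat \<Rightarrow> nat"
  where "max_union H i = Max {card (\<Union>T) | T. T \<subseteq> H \<and> card T = i}"

definition nbrs :: "'a set set \<Rightarrow> 'a set \<Rightarrow> 'a set"
  where "nbrs G A = {u. \<exists>a\<in>A. {a, u} \<in> G \<and> u \<noteq> a}"

text \<open>
Halmos and Vaughan's argument. If a nonempty proper subset \<open>A\<close> of \<open>Y\<close> satisfies Hall's condition with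
equality, \<open>A\<close> and its complement can be matched separately, the complement avoiding the neighbours of
\<open>A\<close>. Otherwise there is room to match any one element arbitrarily and to delete its partner.
\<close>

lemma hall_marriage:
  assumes "finite Y" and "\<forall>x\<in>Y. finite (N x)" and "\<forall>A\<subseteq>Y. card A \<le> card (\<Union>(N ` A))"
  shows "\<exists>\<phi>. inj_on \<phi> Y \<and> (\<forall>x\<in>Y. \<phi> x \<in> N x)"
  using assms
proof (induction "card Y" arbitrary: Y N rule: less_induct)
  case less
  note fin = less.prems(1,2) and hall = less.prems(3)
  have finN: "finite (\<Union>(N ` A))" if "A \<subseteq> Y" for A
    using that fin by (meson finite_UN finite_subset in_mono)
  show ?case
  proof (cases "\<exists>A. A \<subset> Y \<and> A \<noteq> {} \<and> card A = card (\<Union>(N ` A))")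
    case True
    then obtain A where A: "A \<subset> Y" "A \<noteq> {}" "card A = card (\<Union>(N ` A))" by blast
    have fA: "finite A" using A(1) fin(1) by (meson finite_subset psubset_imp_subset)
    have lA: "card A < card Y" using A(1) fin(1) psubset_card_mono by blast
    have "\<exists>\<phi>. inj_on \<phi> A \<and> (\<forall>x\<in>A. \<phi> x \<in> N x)"
    proof (rule less.hyps[OF lA fA])
      show "\<forall>x\<in>A. finite (N x)" using A(1) fin(2) by auto
      show "\<forall>B\<subseteq>A. card B \<le> card (\<Union>(N ` B))" using A(1) hall by auto
    qed
    then obtain \<phi> where \<phi>: "inj_on \<phi> A" "\<forall>x\<in>A. \<phi> x \<in> N x" by blast
    define N' where "N' x = N x - \<Union>(N ` A)" for x
    have l2: "card (Y - A) < card Y"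
      using A(1,2) fin(1) by (intro psubset_card_mono) auto
    have "\<exists>\<psi>. inj_on \<psi> (Y - A) \<and> (\<forall>x\<in>Y - A. \<psi> x \<in> N' x)"
    proof (rule less.hyps[OF l2])
      show "\<forall>B\<subseteq>Y - A. card B \<le> card (\<Union>(N' ` B))"
      proof (intro allI impI)
        fix B assume B: "B \<subseteq> Y - A"
        have fB: "finite B" using B fin(1) finite_subset by blast
        have "card A + card B = card (A \<union> B)"
          using B fA fB by (subst card_Un_disjoint) auto
        also have "\<dots> \<le> card (\<Union>(N ` (A \<union> B)))"
          by (rule hall[rule_format]) (use A(1) B in auto)
        also have "\<Union>(N ` (A \<union> B)) = \<Union>(N ` A) \<union> \<Union>(N' ` B)" by (auto simp: N'_def)
        also have "card \<dots> \<le> card (\<Union>(N ` A)) + card (\<Union>(N' ` B))" by (rule card_Un_le)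
        finally show "card B \<le> card (\<Union>(N' ` B))" using A(3) by simp
      qed
    qed (use fin in \<open>auto simp: N'_def\<close>)
    then obtain \<psi> where \<psi>: "inj_on \<psi> (Y - A)" "\<forall>x\<in>Y - A. \<psi> x \<in> N' x" by blast
    let ?f = "\<lambda>x. if x \<in> A then \<phi> x else \<psi> x"
    have "inj_on ?f Y"
    proof (rule inj_onI)
      fix x y assume xy: "x \<in> Y" "y \<in> Y" "?f x = ?f y"
      show "x = y"
      proof (cases "x \<in> A \<longleftrightarrow> y \<in> A")
        case True
        then show ?thesis using xy inj_onD[OF \<phi>(1), of x y] inj_onD[OF \<psi>(1), of x y] by (cases "x \<in> A") auto
      next
        case False
        have "\<phi> u \<noteq> \<psi> v" if "u \<in> A" "v \<in> Y - A" for u v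
        proof -
          have "\<phi> u \<in> \<Union>(N ` A)" using that(1) \<phi>(2) by auto
          moreover have "\<psi> v \<in> N' v" using that(2) \<psi>(2) by auto
          ultimately show ?thesis unfolding N'_def by auto
        qed
        note ne = this
        show ?thesis using xy False ne[of x y] ne[of y x] by (cases "x \<in> A") auto
      qed
    qed
    moreover have "\<forall>x\<in>Y. ?f x \<in> N x" using \<phi>(2) \<psi>(2) by (simp add: N'_def)
    ultimately show ?thesis by (intro exI[of _ ?f] conjI)
  next
    case False
    then have nocrit: "card A \<noteq> card (\<Union>(N ` A))" if "A \<subset> Y" "A \<noteq> {}" for A
      using that by blast
    show ?thesis
    proof (cases "Y = {}")
      case False
      then obtain x where x: "x \<in> Y" by blast
      have "card {x} \<le> card (\<Union>(N ` {x}))"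
        by (rule hall[rule_format]) (use x in simp)
      then have "N x \<noteq> {}" by auto
      then obtain y where y: "y \<in> N x" by blast
      have l2: "card (Y - {x}) < card Y"
        using x fin(1) by (intro psubset_card_mono) auto
      have "\<exists>\<psi>. inj_on \<psi> (Y - {x}) \<and> (\<forall>z\<in>Y - {x}. \<psi> z \<in> N z - {y})"
      proof (rule less.hyps[OF l2])
        show "\<forall>B\<subseteq>Y - {x}. card B \<le> card (\<Union>z\<in>B. N z - {y})"
        proof (intro allI impI)
          fix B assume B: "B \<subseteq> Y - {x}"
          show "card B \<le> card (\<Union>z\<in>B. N z - {y})"
          proof (cases "B = {}")
            case False
            have "card B \<noteq> card (\<Union>(N ` B))"
              using nocrit[of B] B False x by auto
            moreover have "card B \<le> card (\<Union>(N ` B))"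
              by (rule hall[rule_format]) (use B in auto)
            ultimately have "card B < card (\<Union>(N ` B))" by simp
            moreover have "(\<Union>z\<in>B. N z - {y}) = \<Union>(N ` B) - {y}" by auto
            moreover have "card (\<Union>(N ` B)) - card {y} \<le> card (\<Union>(N ` B) - {y})"
              by (rule diff_card_le_card_Diff) simp
            ultimately show ?thesis by simp
          qed simp
        qed
      qed (use fin in auto)
      then obtain \<psi> where \<psi>: "inj_on \<psi> (Y - {x})" "\<forall>z\<in>Y - {x}. \<psi> z \<in> N z - {y}" by blast
      have "inj_on (\<psi>(x := y)) Y"
      proof (rule inj_onI)
        fix u v assume "u \<in> Y" "v \<in> Y" "(\<psi>(x := y)) u = (\<psi>(x := y)) v"
        then show "u = v" using inj_onD[OF \<psi>(1), of u v] \<psi>(2)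
          by (metis DiffD2 DiffI fun_upd_apply insertI1 singletonD)
      qed
      moreover have "\<forall>z\<in>Y. (\<psi>(x := y)) z \<in> N z" using \<psi>(2) y by simp
      ultimately show ?thesis by (intro exI[of _ "\<psi>(x := y)"] conjI)
    qed auto
  qed
qed

lemma nbrs_subset_cover: "hits D G \<Longrightarrow> A \<inter> D = {} \<Longrightarrow> nbrs G A \<subseteq> D"
  by (fastforce simp: hits_def nbrs_def)

lemma nbrs_UN: "nbrs G A = (\<Union>a\<in>A. nbrs G {a})"
  by (auto simp: nbrs_def)

text \<open>
The exchange behind the theorem. Suppose that \<open>A\<close> is a minimal violator of Hall's condition and that
a minimum cover \<open>D'\<close> contains some \<open>a \<in> A\<close>. Removing \<open>a\<close> leaves a set that is matched perfectly with
the neighbours of \<open>A\<close>. A neighbour missing from \<open>D'\<close> forces its partner into \<open>D'\<close>, so \<open>D'\<close> misses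
fewer neighbours of \<open>A\<close> than it contains elements of \<open>A\<close>. Replacing the latter by all neighbours of \<open>A\<close>
would give a smaller cover.
\<close>

lemma critical_violator_avoids_minimum_covers:
  assumes G: "\<forall>e\<in>G. card e = 2"
    and D: "hits D G" "finite D"
    and D': "hits D' G" "finite D'" "\<And>D''. finite D'' \<Longrightarrow> hits D'' G \<Longrightarrow> card D' \<le> card D''"
    and A: "finite A" "A \<inter> D = {}" "card (nbrs G A) < card A"
      "\<And>B. B \<subset> A \<Longrightarrow> card B \<le> card (nbrs G B)"
  shows "A \<inter> D' = {}"
proof (rule ccontr)
  assume "A \<inter> D' \<noteq> {}"
  then obtain a where a: "a \<in> A" "a \<in> D'" by blast
  have ND: "nbrs G A \<subseteq> D" by (rule nbrs_subset_cover[OF D(1) A(2)])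
  then have finN: "finite (nbrs G A)" using D(2) finite_subset by blast
  have finNb: "finite (nbrs G B)" if "B \<subseteq> A" for B
    using that by (intro finite_subset[OF _ finN]) (auto simp: nbrs_def)
  have "\<exists>\<phi>. inj_on \<phi> (A - {a}) \<and> (\<forall>x\<in>A - {a}. \<phi> x \<in> nbrs G {x})"
  proof (rule hall_marriage)
    show "\<forall>B\<subseteq>A - {a}. card B \<le> card (\<Union>x\<in>B. nbrs G {x})"
      using A(4) a(1) by (auto simp flip: nbrs_UN)
  qed (use A(1) finNb in auto)
  then obtain \<phi> where \<phi>: "inj_on \<phi> (A - {a})" "\<forall>x\<in>A - {a}. \<phi> x \<in> nbrs G {x}" by blast
  have sub: "\<phi> ` (A - {a}) \<subseteq> nbrs G A" using \<phi>(2) by (auto simp: nbrs_def)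
  have im: "\<phi> ` (A - {a}) = nbrs G A"
  proof (rule card_seteq[OF finN sub])
    show "card (nbrs G A) \<le> card (\<phi> ` (A - {a}))"
      using A(1,3) a(1) by (simp add: card_image[OF \<phi>(1)])
  qed
  let ?D = "(D' - A) \<union> nbrs G A"
  have "hits ?D G"
    unfolding hits_def
  proof
    fix e assume e: "e \<in> G"
    obtain v where v: "v \<in> D'" "v \<in> e" using D'(1) e by (auto simp: hits_def)
    show "?D \<inter> e \<noteq> {}"
    proof (cases "v \<in> A")
      case True
      obtain w where "e = {v, w}" "w \<noteq> v"
        using G e v(2) by (metis card_2_iff insertE insert_commute singletonD)
      then have "w \<in> nbrs G A" "w \<in> e" using True e by (auto simp: nbrs_def)
      then show ?thesis by blast
    qed (use v in blast)
  qed
  then have le: "card D' \<le> card ?D" by (rule D'(3)[rotated]) (use D'(2) finN in simp)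
  have "nbrs G A - D' \<subseteq> \<phi> ` (A \<inter> D' - {a})"
  proof
    fix u assume u: "u \<in> nbrs G A - D'"
    then obtain x where x: "x \<in> A - {a}" "u = \<phi> x" using im by blast
    then have "{x, u} \<in> G" using \<phi>(2) by (auto simp: nbrs_def)
    then have "x \<in> D'" using u D'(1) by (auto simp: hits_def)
    then show "u \<in> \<phi> ` (A \<inter> D' - {a})" using x by blast
  qed
  then have "card (nbrs G A - D') \<le> card (A \<inter> D' - {a})"
    using A(1) by (meson card_image_le card_mono finite_Diff finite_Int finite_imageI le_trans)
  also have "\<dots> < card (A \<inter> D')" using a A(1) by (intro psubset_card_mono) auto
  finally have lt: "card (nbrs G A - D') < card (A \<inter> D')" .
  have "?D = (D' - A) \<union> (nbrs G A - D')" using ND A(2) by auto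
  then have "card ?D \<le> card (D' - A) + card (nbrs G A - D')" by (metis card_Un_le)
  also have "\<dots> < card (D' - A) + card (D' \<inter> A)" using lt by (simp add: Int_commute)
  also have "\<dots> = card D'" using D'(2) by (metis add.commute card_Int_Diff)
  finally show False using le by simp
qed

lemma critical_violator_exists:
  assumes "finite Y" "\<not> (\<forall>A\<subseteq>Y. card A \<le> card (nbrs G A))"
  obtains A where "A \<subseteq> Y" "A \<noteq> {}" "finite A" "card (nbrs G A) < card A"
    "\<And>B. B \<subset> A \<Longrightarrow> card B \<le> card (nbrs G B)"
proof -
  let ?S = "{A. A \<subseteq> Y \<and> card (nbrs G A) < card A}"
  have "finite ?S" using assms(1) by simp
  moreover have "?S \<noteq> {}" using assms(2) by (auto simp: not_le)
  ultimately obtain A where A: "A \<in> ?S" "\<And>B. B \<in> ?S \<Longrightarrow> B \<subseteq> A \<Longrightarrow> A = B"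
    using finite_has_minimal[of ?S] by auto
  show ?thesis
  proof (rule that)
    show "A \<subseteq> Y" "card (nbrs G A) < card A" using A(1) by auto
    then show "A \<noteq> {}" "finite A" using assms(1) finite_subset by auto
    show "card B \<le> card (nbrs G B)" if "B \<subset> A" for B
    proof (rule ccontr)
      assume "\<not> ?thesis"
      then have "B \<in> ?S" using that \<open>A \<subseteq> Y\<close> by auto
      then show False using A(2) that by blast
    qed
  qed
qed

text \<open>
By Hall's theorem \<open>Y\<close> is matched into \<open>D\<close>. Give each vertex of \<open>D\<close> its matching edge, or an edge that
meets \<open>D\<close> in this vertex only. The edges chosen are distinct since each meets \<open>D\<close> in exactly one point.
\<close>

lemma edges_covering_matched_set:
  assumes D: "finite D" "hits D G" "\<And>u. u \<in> D \<Longrightarrow> \<not> hits (D - {u}) G"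
    and Y: "finite Y" "Y \<inter> D = {}" "\<forall>A\<subseteq>Y. card A \<le> card (nbrs G A)"
  shows "\<exists>T\<subseteq>G. card T = card D \<and> Y \<union> D \<subseteq> \<Union>T"
proof -
  have "nbrs G Y \<subseteq> D" by (rule nbrs_subset_cover[OF D(2) Y(2)])
  then have finN: "finite (nbrs G {x})" if "x \<in> Y" for x
    using that by (intro finite_subset[OF _ finite_subset[OF \<open>nbrs G Y \<subseteq> D\<close> D(1)]]) (auto simp: nbrs_def)
  have "\<exists>\<phi>. inj_on \<phi> Y \<and> (\<forall>x\<in>Y. \<phi> x \<in> nbrs G {x})"
    by (rule hall_marriage) (use Y finN in \<open>auto simp flip: nbrs_UN\<close>)
  then obtain \<phi> where \<phi>: "inj_on \<phi> Y" "\<forall>x\<in>Y. \<phi> x \<in> nbrs G {x}" by blast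
  have \<phi>D: "\<phi> x \<in> D" "{x, \<phi> x} \<in> G" if "x \<in> Y" for x
    using that \<phi>(2) \<open>nbrs G Y \<subseteq> D\<close> by (auto simp: nbrs_def)
  have "\<exists>e. e \<in> G \<and> e \<inter> D = {u} \<and> (\<forall>x\<in>Y. \<phi> x = u \<longrightarrow> x \<in> e)" if u: "u \<in> D" for u
  proof (cases "u \<in> \<phi> ` Y")
    case True
    then obtain x where x: "x \<in> Y" "u = \<phi> x" by blast
    show ?thesis
      by (rule exI[of _ "{x, u}"]) (use x u \<phi>D Y(2) \<phi>(1) in \<open>auto simp: inj_on_def\<close>)
  next
    case False
    obtain e where "e \<in> G" "(D - {u}) \<inter> e = {}" using D(3)[OF u] by (auto simp: hits_def)
    moreover have "D \<inter> e \<noteq> {}" using \<open>e \<in> G\<close> D(2) by (auto simp: hits_def)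
    ultimately show ?thesis using False by (intro exI[of _ e]) auto
  qed
  then obtain E where E: "\<And>u. u \<in> D \<Longrightarrow> E u \<in> G \<and> E u \<inter> D = {u} \<and> (\<forall>x\<in>Y. \<phi> x = u \<longrightarrow> x \<in> E u)"
    by metis
  have "inj_on E D" by (rule inj_onI) (metis E singleton_inject)
  then have "card (E ` D) = card D" by (rule card_image)
  moreover have "E ` D \<subseteq> G" using E by blast
  moreover have "Y \<union> D \<subseteq> \<Union>(E ` D)"
  proof
    fix v assume "v \<in> Y \<union> D"
    then show "v \<in> \<Union>(E ` D)"
    proof
      assume "v \<in> Y" then show ?thesis using E \<phi>D by blast
    next
      assume "v \<in> D" then show ?thesis using E by blast
    qed
  qed
  ultimately show ?thesis by blast
qed

lemma minimum_cover_private: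
  assumes "finite D" "\<And>D'. finite D' \<Longrightarrow> hits D' G \<Longrightarrow> card D \<le> card D'" "u \<in> D"
  shows "\<not> hits (D - {u}) G"
proof
  assume "hits (D - {u}) G"
  then have "card D \<le> card (D - {u})" using assms by blast
  then show False using assms(1,3) by (metis card_Diff1_less not_le)
qed

definition min_hitting :: "'a set set \<Rightarrow> nat \<Rightarrow> 'a set set"
  where "min_hitting H c = {C. finite C \<and> card C = c \<and> hits C H}"

text \<open>
Let \<open>G\<close> be the edges of size two and \<open>D\<close> a minimum cover of \<open>G\<close>. Either \<open>D\<close> has \<open>c\<close> vertices, and the
minimum hitting sets of \<open>H\<close> are among the minimum covers of \<open>G\<close>; or \<open>D\<close> has \<open>c - 1\<close> vertices and
misses \<open>B\<close>. In the second case a hitting set of size \<open>c\<close> through \<open>b \<in> B\<close> is, without \<open>b\<close>, a minimum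
cover of the edges of \<open>G\<close> that avoid \<open>b\<close>, and \<open>D\<close> is also a cover of these edges.
\<close>

lemma union_min_hitting_covered:
  assumes B: "\<forall>e\<in>H. e \<noteq> B \<longrightarrow> card e = 2"
    and min: "\<And>C. finite C \<Longrightarrow> hits C H \<Longrightarrow> c \<le> card C"
    and ne: "min_hitting H c \<noteq> {}"
    and finW: "finite (\<Union>(min_hitting H c))"
  shows "\<exists>T\<subseteq>H. card T = c \<and> \<Union>(min_hitting H c) \<subseteq> \<Union>T"
proof -
  define W where "W = \<Union>(min_hitting H c)"
  have finW: "finite W" using finW by (simp add: W_def)
  define G where "G = {e \<in> H. card e = 2}"
  have G2: "\<forall>e\<in>G. card e = 2" and GH: "G \<subseteq> H" by (auto simp: G_def)
  show ?thesis
  proof (cases "\<forall>D. finite D \<and> hits D G \<longrightarrow> c \<le> card D")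
    case minG: True
    obtain D where D: "finite D" "card D = c" "hits D H" using ne by (auto simp: min_hitting_def)
    have hD: "hits D G" using D(3) GH by (auto simp: hits_def)
    have hall: "\<forall>A\<subseteq>W - D. card A \<le> card (nbrs G A)"
    proof (rule ccontr)
      assume *: "\<not> ?thesis"
      have "finite (W - D)" using finW by simp
      from critical_violator_exists[OF this *] obtain A where A: "A \<subseteq> W - D" "A \<noteq> {}" "finite A" "card (nbrs G A) < card A"
        "\<And>B. B \<subset> A \<Longrightarrow> card B \<le> card (nbrs G B)"
        by metis
      have "A \<inter> C = {}" if "C \<in> min_hitting H c" for C
        by (rule critical_violator_avoids_minimum_covers[OF G2 hD D(1)])
          (use that A minG GH in \<open>auto simp: min_hitting_def hits_def\<close>)
      then have "A \<inter> W = {}" unfolding W_def by blast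
      then show False using A(1,2) by blast
    qed
    have "\<exists>T\<subseteq>G. card T = card D \<and> (W - D) \<union> D \<subseteq> \<Union>T"
      by (rule edges_covering_matched_set[OF D(1) hD minimum_cover_private])
        (use D minG hall finW in auto)
    then obtain T where T: "T \<subseteq> G" "card T = card D" "(W - D) \<union> D \<subseteq> \<Union>T" by blast
    then have "W \<subseteq> \<Union>T" by blast
    then show ?thesis using T GH D(2) unfolding W_def by (intro exI[of _ T]) auto
  next
    case False
    then obtain D where D: "finite D" "hits D G" "card D < c" by (auto simp: not_le)
    have "\<not> hits D H" using min D by fastforce
    then have BH: "B \<in> H" "D \<inter> B = {}" using D(2) B by (auto simp: hits_def G_def)
    then have BG: "B \<notin> G" using D(2) by (auto simp: hits_def)
    have HG: "H = insert B G" using B BH by (auto simp: G_def)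
    have "B \<noteq> {}" using ne BH by (auto simp: min_hitting_def hits_def)
    then obtain b0 where b0: "b0 \<in> B" by blast
    \<comment> \<open>adding a vertex of \<open>B\<close> to a cover of \<open>G\<close> gives a hitting set\<close>
    have minG: "c \<le> Suc (card D')" if "finite D'" "hits D' G" for D'
    proof -
      have "hits (insert b0 D') H" using that b0 by (auto simp: HG hits_def)
      then have "c \<le> card (insert b0 D')" using min that by blast
      also have "\<dots> \<le> Suc (card D')" using that(1) by (simp add: card_insert_if)
      finally show ?thesis .
    qed
    have cD: "c = Suc (card D)" using minG[OF D(1,2)] D(3) by simp
    have hall: "\<forall>A\<subseteq>W - D - B. card A \<le> card (nbrs G A)"
    proof (rule ccontr)
      assume *: "\<not> ?thesis"
      have "finite (W - D - B)" using finW by simp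
      from critical_violator_exists[OF this *] obtain A where A: "A \<subseteq> W - D - B" "A \<noteq> {}" "finite A" "card (nbrs G A) < card A"
        "\<And>B. B \<subset> A \<Longrightarrow> card B \<le> card (nbrs G B)"
        by metis
      obtain v where vA: "v \<in> A" using A(2) by blast
      then have "v \<in> W" using A(1) by blast
      then obtain C where v: "v \<in> A" "v \<in> C" "C \<in> min_hitting H c"
        using vA unfolding W_def by blast
      then have C: "finite C" "card C = c" "hits C H" by (auto simp: min_hitting_def)
      then obtain b where b: "b \<in> C" "b \<in> B" using BH by (auto simp: hits_def)
      define Gb where "Gb = {e \<in> G. b \<notin> e}"
      have ND: "nbrs G A \<subseteq> D" by (rule nbrs_subset_cover) (use D A in auto)
      have nb: "nbrs Gb A' = nbrs G A'" if "A' \<subseteq> A" for A'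
      proof -
        have "b \<notin> {a, u}" if "a \<in> A'" "{a, u} \<in> G" "u \<noteq> a" for a u
        proof -
          have "u \<in> D" using that \<open>A' \<subseteq> A\<close> ND unfolding nbrs_def by blast
          moreover have "a \<notin> B" using that(1) \<open>A' \<subseteq> A\<close> A(1) by blast
          ultimately show ?thesis using b(2) BH(2) by blast
        qed
        then show ?thesis unfolding nbrs_def Gb_def by blast
      qed
      have "A \<inter> (C - {b}) = {}"
      proof (rule critical_violator_avoids_minimum_covers[of Gb D])
        show "\<forall>e\<in>Gb. card e = 2" "hits D Gb" using G2 D by (auto simp: Gb_def hits_def)
        show "hits (C - {b}) Gb" unfolding hits_def
        proof
          fix e assume "e \<in> Gb"
          then have "e \<in> H" "b \<notin> e" using GH by (auto simp: Gb_def)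
          then show "(C - {b}) \<inter> e \<noteq> {}" using C(3) unfolding hits_def by blast
        qed
        show "card (C - {b}) \<le> card D''" if "finite D''" "hits D'' Gb" for D''
        proof -
          have "hits (insert b D'') H" using that b by (auto simp: HG Gb_def hits_def)
          then have "c \<le> card (insert b D'')" using min that by blast
          also have "\<dots> \<le> Suc (card D'')" using that(1) by (simp add: card_insert_if)
          finally show ?thesis using C b by simp
        qed
        show "card (nbrs Gb A) < card A" using nb A(4) by simp
        show "card B \<le> card (nbrs Gb B)" if "B \<subset> A" for B using nb A(5) that by auto
      qed (use D C A in auto)
      then show False using v b A(1) by blast
    qed
    have "\<exists>T\<subseteq>G. card T = card D \<and> (W - D - B) \<union> D \<subseteq> \<Union>T"
      by (rule edges_covering_matched_set[OF D(1,2) minimum_cover_private])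
        (use D minG cD hall finW in auto)
    then obtain T where T: "T \<subseteq> G" "card T = card D" "(W - D - B) \<union> D \<subseteq> \<Union>T" by blast
    have "finite T" using T(2) D(1) BH
      by (cases "D = {}") (use T D in \<open>auto simp: hits_def intro: card_ge_0_finite\<close>)
    then have "card (insert B T) = c" using T BG cD by (subst card_insert_disjoint) auto
    moreover have "insert B T \<subseteq> H" using T HG by auto
    moreover have "W \<subseteq> \<Union>(insert B T)" using T by auto
    ultimately show ?thesis unfolding W_def by (intro exI[of _ "insert B T"]) auto
  qed
qed

lemma finite_card_unions:
  assumes "finite H"
  shows "finite {card (\<Union>T) | T. T \<subseteq> H \<and> card T = i}"
proof -
  have "{card (\<Union>T) | T. T \<subseteq> H \<and> card T = i} \<subseteq> (\<lambda>T. card (\<Union>T)) ` Pow H" by auto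
  then show ?thesis using assms by (meson finite_Pow_iff finite_imageI finite_subset)
qed

lemma max_union_ge: "finite H \<Longrightarrow> T \<subseteq> H \<Longrightarrow> card (\<Union>T) \<le> max_union H (card T)"
  unfolding max_union_def by (rule Max_ge[OF finite_card_unions]) auto

lemma max_union_mono:
  assumes "finite H" "H' \<subseteq> H" "i \<le> card H'"
  shows "max_union H' i \<le> max_union H i"
  unfolding max_union_def
proof (rule Max_mono)
  obtain T where "T \<subseteq> H'" "card T = i" using assms(3) obtain_subset_with_card_n by metis
  then show "{card (\<Union>T) | T. T \<subseteq> H' \<and> card T = i} \<noteq> {}" by blast
  show "{card (\<Union>T) | T. T \<subseteq> H' \<and> card T = i} \<subseteq> {card (\<Union>T) | T. T \<subseteq> H \<and> card T = i}"
    by (rule Collect_mono) (use assms(2) in \<open>metis subset_trans\<close>)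
qed (rule finite_card_unions[OF assms(1)])

text \<open>
Choosing a vertex in each edge gives a hitting set. This guarantees that the maxima in \<open>max_union\<close> are
taken over nonempty sets.
\<close>

lemma hitting_number_le_card:
  assumes "finite H" "\<And>C. finite C \<Longrightarrow> hits C H \<Longrightarrow> c \<le> card C" "{} \<notin> H"
  shows "c \<le> card H"
proof -
  have "hits ((\<lambda>e. SOME v. v \<in> e) ` H) H"
    using assms(3) by (auto simp: hits_def disjoint_iff) (metis all_not_in_conv some_in_eq)
  then have "c \<le> card ((\<lambda>e. SOME v. v \<in> e) ` H)" using assms by blast
  also have "\<dots> \<le> card H" using assms(1) by (rule card_image_le)
  finally show ?thesis .
qed

lemma min_hitting_subset_vertices:
  assumes "\<And>C. finite C \<Longrightarrow> hits C H \<Longrightarrow> c \<le> card C" "C \<in> min_hitting H c"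
  shows "C \<subseteq> \<Union>H"
proof
  fix v assume v: "v \<in> C"
  have C: "finite C" "card C = c" "hits C H" using assms(2) by (auto simp: min_hitting_def)
  have "\<not> hits (C - {v}) H"
    by (rule minimum_cover_private) (use C assms(1) v in auto)
  then show "v \<in> \<Union>H" using C(3) by (auto simp: hits_def)
qed

text \<open>
The sets through a fixed vertex \<open>v\<close> are controlled by the edges that avoid \<open>v\<close>, a hypergraph of the same
kind with smaller covering number and smaller values of \<open>max_union\<close>.
\<close>

theorem min_hitting_bound:
  assumes "finite H" "\<forall>e\<in>H. finite e" "\<forall>e\<in>H. e \<noteq> B \<longrightarrow> card e = 2"
    and "\<And>C. finite C \<Longrightarrow> hits C H \<Longrightarrow> c \<le> card C"
  shows "fact c * card (min_hitting H c) \<le> (\<Prod>i=1..c. max_union H i)"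
  using assms
proof (induction c arbitrary: H)
  case 0
  have "min_hitting H 0 \<subseteq> {{} :: 'a set}" by (auto simp: min_hitting_def)
  from card_mono[OF _ this] show ?case by simp
next
  case (Suc c)
  note min = Suc.prems(4)
  define M where "M = min_hitting H (Suc c)"
  define W where "W = \<Union>M"
  let ?P = "\<Prod>i=1..c. max_union H i"
  have "fact (Suc c) * card M \<le> (\<Prod>i=1..Suc c. max_union H i)"
  proof (cases "M = {}")
    case False
    have sub: "C \<subseteq> \<Union>H" if "C \<in> M" for C
      by (rule min_hitting_subset_vertices[OF min that[unfolded M_def]])
    have finV: "finite (\<Union>H)" using Suc.prems by blast
    have "M \<subseteq> Pow (\<Union>H)" using sub by blast
    then have finM: "finite M" using finV by (meson finite_Pow_iff finite_subset)
    have "W \<subseteq> \<Union>H" using sub unfolding W_def by blast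
    then have finW: "finite W" using finV finite_subset by blast
    have "{} \<notin> H" using False by (auto simp: M_def min_hitting_def hits_def)
    obtain T where T: "T \<subseteq> H" "card T = Suc c" "W \<subseteq> \<Union>T"
      using union_min_hitting_covered[OF Suc.prems(3) min] False finW unfolding M_def W_def by blast
    have W: "card W \<le> max_union H (Suc c)"
    proof -
      have "card W \<le> card (\<Union>T)"
        using T finV by (meson Union_mono card_mono finite_subset)
      also have "\<dots> \<le> max_union H (Suc c)" using max_union_ge[OF Suc.prems(1) T(1)] T(2) by simp
      finally show ?thesis .
    qed
    have card_link: "fact c * card {C \<in> M. v \<in> C} \<le> ?P" for v
    proof -
      define Hv where "Hv = {e \<in> H. v \<notin> e}"
      have minv: "c \<le> card C" if "finite C" "hits C Hv" for C
      proof -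
        have "hits (insert v C) H" using that by (auto simp: Hv_def hits_def)
        then have "Suc c \<le> card (insert v C)" using min that by blast
        also have "\<dots> \<le> Suc (card C)" using that(1) by (simp add: card_insert_if)
        finally show ?thesis by simp
      qed
      have IH: "fact c * card (min_hitting Hv c) \<le> (\<Prod>i=1..c. max_union Hv i)"
        by (rule Suc.IH) (use Suc.prems minv in \<open>auto simp: Hv_def\<close>)
      have finHv: "finite (min_hitting Hv c)"
      proof (rule finite_subset)
        show "min_hitting Hv c \<subseteq> Pow (\<Union>H)"
          using min_hitting_subset_vertices[OF minv] by (fastforce simp: Hv_def)
      qed (use finV in simp)
      have "card {C \<in> M. v \<in> C} \<le> card (min_hitting Hv c)"
      proof (rule card_inj_on_le[OF _ _ finHv])
        show "inj_on (\<lambda>C. C - {v}) {C \<in> M. v \<in> C}"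
          by (rule inj_onI) (metis (mono_tags, lifting) insert_Diff mem_Collect_eq)
        show "(\<lambda>C. C - {v}) ` {C \<in> M. v \<in> C} \<subseteq> min_hitting Hv c"
          by (fastforce simp: M_def min_hitting_def Hv_def hits_def)
      qed
      then have "fact c * card {C \<in> M. v \<in> C} \<le> fact c * card (min_hitting Hv c)" by simp
      also note IH
      also have "(\<Prod>i=1..c. max_union Hv i) \<le> ?P"
      proof (rule prod_mono, intro conjI)
        fix i assume i: "i \<in> {1..c}"
        have "c \<le> card Hv"
          by (rule hitting_number_le_card[OF _ minv]) (use \<open>{} \<notin> H\<close> Suc.prems(1) in \<open>auto simp: Hv_def\<close>)
        then show "max_union Hv i \<le> max_union H i"
          using i Suc.prems(1) by (intro max_union_mono) (auto simp: Hv_def)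
      qed simp
      finally show ?thesis .
    qed
    \<comment> \<open>count pairs of a vertex and a minimum hitting set containing it\<close>
    have "Suc c * card M = (\<Sum>C\<in>M. card C)" by (simp add: M_def min_hitting_def)
    also have "\<dots> = (\<Sum>C\<in>M. \<Sum>v\<in>W. if v \<in> C then 1 else 0)"
    proof (rule sum.cong)
      fix C assume C: "C \<in> M"
      then have "W \<inter> C = C" unfolding W_def by blast
      then show "card C = (\<Sum>v\<in>W. if v \<in> C then 1 else 0)"
        using finW by (simp add: sum.If_cases)
    qed simp
    also have "\<dots> = (\<Sum>v\<in>W. \<Sum>C\<in>M. if v \<in> C then 1 else 0)" by (rule sum.swap)
    also have "\<dots> = (\<Sum>v\<in>W. card {C \<in> M. v \<in> C})"
      using finM by (simp add: sum.If_cases Int_def)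
    finally have count: "Suc c * card M = (\<Sum>v\<in>W. card {C \<in> M. v \<in> C})" .
    have "fact (Suc c) * card M = fact c * (Suc c * card M)" by (simp add: algebra_simps)
    also have "\<dots> = (\<Sum>v\<in>W. fact c * card {C \<in> M. v \<in> C})" unfolding count sum_distrib_left ..
    also have "\<dots> \<le> (\<Sum>v\<in>W. ?P)" by (rule sum_mono) (rule card_link)
    also have "\<dots> = card W * ?P" by simp
    also have "\<dots> \<le> max_union H (Suc c) * ?P" using W by simp
    finally show ?thesis by (simp add: mult.commute)
  qed simp
  then show ?case unfolding M_def .
qed

section \<open>Monomial ideals\<close>

lemma S_ring_sel [simp]:
  "carrier (S_ring :: ('x, 'k::field) mpoly ring) = UNIV"
  "f \<otimes>\<^bsub>(S_ring :: ('x, 'k) mpoly ring)\<^esub> g = f * g"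
  "f \<oplus>\<^bsub>(S_ring :: ('x, 'k) mpoly ring)\<^esub> g = f + g"
  "\<zero>\<^bsub>(S_ring :: ('x, 'k) mpoly ring)\<^esub> = 0"
  "\<one>\<^bsub>(S_ring :: ('x, 'k) mpoly ring)\<^esub> = 1"
  by (simp_all add: ring_of_type_algebra_def)

lemma cring_S_ring: "cring (S_ring :: ('x, 'k::field) mpoly ring)"
  by (rule cring_from_type_algebra)

lemma ring_S_ring: "ring (S_ring :: ('x, 'k::field) mpoly ring)"
  by (rule ring_from_type_algebra)

lemma S_ring_a_inv [simp]: "\<ominus>\<^bsub>(S_ring :: ('x, 'k::field) mpoly ring)\<^esub> f = - f"
proof -
  interpret ring "S_ring :: ('x, 'k) mpoly ring" by (rule ring_S_ring)
  show ?thesis using minus_equality[of "- f" f] by simp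
qed

text \<open>
Ideals of the record \<open>S_ring\<close> are handled through the type class operations on polynomials.
\<close>

lemma ideal_S_ringI:
  fixes I :: "('x, 'k::field) mpoly set"
  assumes "0 \<in> I" "\<And>f g. f \<in> I \<Longrightarrow> g \<in> I \<Longrightarrow> f + g \<in> I" "\<And>f g. g \<in> I \<Longrightarrow> f * g \<in> I"
  shows "ideal I S_ring"
proof (rule idealI[OF ring_S_ring])
  show "subgroup I (add_monoid (S_ring :: ('x, 'k) mpoly ring))"
  proof (rule group.subgroupI)
    show "group (add_monoid (S_ring :: ('x, 'k) mpoly ring))"
      using ring_S_ring abelian_group.a_group ring.is_abelian_group by blast
    show "I \<noteq> {}" using assms(1) by auto
    show "inv\<^bsub>add_monoid S_ring\<^esub> a \<in> I" if "a \<in> I" for a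
    proof -
      have "inv\<^bsub>add_monoid S_ring\<^esub> a = - a" using S_ring_a_inv[of a] unfolding a_inv_def .
      then show ?thesis using assms(3)[OF that, of "-1"] by (simp only: mult_minus1)
    qed
  qed (use assms(2) in auto)
qed (use assms(3) in \<open>auto simp: mult.commute\<close>)

lemma ideal_S_ringD:
  fixes I :: "('x, 'k::field) mpoly set"
  assumes "ideal I S_ring"
  shows "0 \<in> I" "f \<in> I \<Longrightarrow> g \<in> I \<Longrightarrow> f + g \<in> I" "g \<in> I \<Longrightarrow> f * g \<in> I" "g \<in> I \<Longrightarrow> g * f \<in> I"
    "f \<in> I \<Longrightarrow> - f \<in> I" "f \<in> I \<Longrightarrow> g \<in> I \<Longrightarrow> f - g \<in> I"
proof -
  interpret ideal I "S_ring :: ('x, 'k) mpoly ring" by fact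
  show "0 \<in> I" using additive_subgroup.zero_closed[OF additive_subgroup_axioms] by simp
  show *: "f + g \<in> I" if "f \<in> I" "g \<in> I" for f g
    using additive_subgroup.a_closed[OF additive_subgroup_axioms that] by simp
  show "f * g \<in> I" if "g \<in> I" for f g using I_l_closed[OF that, of f] by simp
  show "g * f \<in> I" if "g \<in> I" for f g using I_r_closed[OF that, of f] by simp
  show **: "- f \<in> I" if "f \<in> I" for f
    using additive_subgroup.a_inv_closed[OF additive_subgroup_axioms that] by simp
  show "f - g \<in> I" if "f \<in> I" "g \<in> I" using *[OF that(1) **[OF that(2)]] by simp
qed

lemma poly_mapping_eq_sum_single:
  "f = (\<Sum>m\<in>Poly_Mapping.keys f. Poly_Mapping.single m (poly_mapping.lookup f m))"
  by (rule poly_mapping_eqI)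
    (auto simp: lookup_sum lookup_single when_def sum.If_cases in_keys_iff intro!: sum.neutral)

lemma keys_single_mult_subset:
  "Poly_Mapping.keys (Poly_Mapping.single a c * f) \<subseteq> (+) a ` Poly_Mapping.keys f"
  using keys_mult[of "Poly_Mapping.single a c" f] by (auto split: if_splits)

text \<open>
Divisibility of monomials is the pointwise order of exponent vectors.
\<close>

lemma expo_le_iff: "(\<exists>k. m = g + k) \<longleftrightarrow> (\<forall>x. poly_mapping.lookup g x \<le> poly_mapping.lookup m x)"
  for m g :: "'x expo"
proof
  assume *: "\<forall>x. poly_mapping.lookup g x \<le> poly_mapping.lookup m x"
  have "m = g + (m - g)"
    by (rule poly_mapping_eqI) (use * in \<open>simp add: lookup_add lookup_minus\<close>)
  then show "\<exists>k. m = g + k" ..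
qed (auto simp: lookup_add)

lemma monomial_add: "monomial (a + b) = monomial a * monomial b"
  by (simp add: monomial_def mult_single)

lemma keys_monomial [simp]: "Poly_Mapping.keys (monomial m :: ('x, 'k::field) mpoly) = {m}"
  by (simp add: monomial_def)

lemma monomial_dvd_iff:
  "monomial m' dvd (monomial m :: ('x, 'k::field) mpoly) \<longleftrightarrow> (\<exists>k. m = m' + k)"
proof
  assume "monomial m' dvd (monomial m :: ('x, 'k) mpoly)"
  then obtain g :: "('x, 'k) mpoly" where g: "monomial m = monomial m' * g" by (auto simp: dvd_def)
  have "m \<in> Poly_Mapping.keys (monomial m' * g)" by (simp flip: g)
  then show "\<exists>k. m = m' + k" using keys_single_mult_subset by (fastforce simp: monomial_def)
qed (auto simp: monomial_add)

lemma ideal_mem_if_monomials_mem: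
  fixes f :: "('x, 'k::field) mpoly"
  assumes I: "ideal I S_ring" and "\<And>m. m \<in> Poly_Mapping.keys f \<Longrightarrow> monomial m \<in> I"
  shows "f \<in> I"
proof -
  have single: "Poly_Mapping.single m c \<in> I" if "m \<in> Poly_Mapping.keys f" for m c
    using ideal_S_ringD(3)[OF I assms(2)[OF that], of "Poly_Mapping.single 0 c"]
    by (simp add: monomial_def mult_single)
  have "(\<Sum>m\<in>S. Poly_Mapping.single m (poly_mapping.lookup f m)) \<in> I"
    if "S \<subseteq> Poly_Mapping.keys f" for S
    using finite_subset[OF that finite_keys] that
    by (induction S rule: finite_induct) (auto intro: ideal_S_ringD[OF I] single)
  then show ?thesis by (subst poly_mapping_eq_sum_single) blast
qed

lemma genideal_monomials:
  fixes A :: "'x expo set"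
  shows "Idl\<^bsub>S_ring\<^esub> (monomial ` A :: ('x, 'k::field) mpoly set)
    = {f. \<forall>m\<in>Poly_Mapping.keys f. \<exists>a\<in>A. \<exists>k. m = a + k}" (is "?I = ?J")
proof
  interpret ring "S_ring :: ('x, 'k) mpoly ring" by (rule ring_S_ring)
  show "?I \<subseteq> ?J"
  proof (rule genideal_minimal)
    show "ideal ?J S_ring"
    proof (rule ideal_S_ringI)
      fix f g :: "('x, 'k) mpoly"
      assume f: "f \<in> ?J" and g: "g \<in> ?J"
      then show "f + g \<in> ?J" using keys_add[of f g] by blast
    next
      fix f g :: "('x, 'k) mpoly"
      assume g: "g \<in> ?J"
      show "f * g \<in> ?J"
      proof safe
        fix m assume "m \<in> Poly_Mapping.keys (f * g)"
        then obtain b c where bc: "m = b + c" "c \<in> Poly_Mapping.keys g" using keys_mult[of f g] by blast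
        with g obtain a k where "a \<in> A" "c = a + k" by blast
        then have "a \<in> A" "m = a + (b + k)" using bc by (auto simp: ac_simps)
        then show "\<exists>a\<in>A. \<exists>k. m = a + k" by blast
      qed
    qed simp
    show "monomial ` A \<subseteq> ?J"
    proof
      fix f :: "('x, 'k) mpoly" assume "f \<in> monomial ` A"
      then obtain a where a: "a \<in> A" "f = monomial a" by blast
      have "a = a + 0" by simp
      then have "\<exists>k. a = a + k" ..
      then have "\<exists>a'\<in>A. \<exists>k. a = a' + k" using a(1) by (intro bexI[of _ a])
      then show "f \<in> ?J" using a(2) by simp
    qed
  qed
  show "?J \<subseteq> ?I"
  proof
    fix f assume f: "f \<in> ?J"
    have I: "ideal ?I S_ring" by (rule genideal_ideal) simp
    show "f \<in> ?I"
    proof (rule ideal_mem_if_monomials_mem[OF I])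
      fix m assume m: "m \<in> Poly_Mapping.keys f"
      obtain a k where a: "a \<in> A" "m = a + k" using f m by blast
      have "monomial a \<in> ?I" using genideal_self[of "monomial ` A"] a(1) by auto
      then have "monomial k * monomial a \<in> ?I" by (rule ideal_S_ringD(3)[OF I])
      then show "monomial m \<in> ?I" by (simp add: monomial_add a(2) mult.commute)
    qed
  qed
qed

lemma monomial_ideal_ideal:
  assumes "monomial_ideal I"
  shows "ideal (I :: ('x, 'k::field) mpoly set) S_ring"
proof -
  interpret ring "S_ring :: ('x, 'k) mpoly ring" by (rule ring_S_ring)
  show ?thesis using assms by (auto simp: monomial_ideal_def intro: genideal_ideal)
qed

lemma mem_monomial_ideal_iff_monomials:
  assumes "monomial_ideal (I :: ('x, 'k::field) mpoly set)"
  shows "f \<in> I \<longleftrightarrow> (\<forall>m\<in>Poly_Mapping.keys f. monomial m \<in> I)"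
  using assms unfolding monomial_ideal_def genideal_monomials by auto

lemma mdeg_add: "mdeg (a + b) = mdeg a + mdeg b"
  by (simp add: mdeg_def lookup_add sum.distrib)

lemma mdeg_eq_0_iff: "mdeg a = 0 \<longleftrightarrow> a = 0"
  by (auto simp: mdeg_def poly_mapping_eq_iff fun_eq_iff)

text \<open>
Descending along proper divisors in the ideal lowers the degree and hence ends in a minimal generator.
\<close>

lemma monomial_mem_iff_GEN:
  fixes I :: "('x::finite, 'k::field) mpoly set"
  assumes "monomial_ideal I"
  shows "monomial m \<in> I \<longleftrightarrow> (\<exists>g\<in>GEN I. \<forall>x. poly_mapping.lookup g x \<le> poly_mapping.lookup m x)"
proof
  assume "monomial m \<in> I"
  then show "\<exists>g\<in>GEN I. \<forall>x. poly_mapping.lookup g x \<le> poly_mapping.lookup m x"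
  proof (induction "mdeg m" arbitrary: m rule: less_induct)
    case less
    show ?case
    proof (cases "m \<in> GEN I")
      case False
      then obtain m' where m': "monomial m' \<in> I" "m' \<noteq> m" "monomial m' dvd (monomial m :: ('x, 'k) mpoly)"
        using less.prems unfolding GEN_def by blast
      then obtain k where k: "m = m' + k" unfolding monomial_dvd_iff by blast
      then have "k \<noteq> 0" using m'(2) by auto
      then have "mdeg m' < mdeg m" using k mdeg_eq_0_iff[of k] by (simp add: mdeg_add)
      from less.hyps[OF this m'(1)] show ?thesis
        unfolding k by (auto simp: lookup_add intro: trans_le_add1)
    qed blast
  qed
next
  assume "\<exists>g\<in>GEN I. \<forall>x. poly_mapping.lookup g x \<le> poly_mapping.lookup m x"
  then obtain g k where g: "g \<in> GEN I" "m = g + k" using expo_le_iff by metis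
  then have "monomial g \<in> I" by (simp add: GEN_def)
  then have "monomial k * monomial g \<in> I" by (rule ideal_S_ringD(3)[OF monomial_ideal_ideal[OF assms]])
  then show "monomial m \<in> I" by (simp add: g(2) monomial_add mult.commute)
qed

section \<open>Contraction of primes along an algebraic element\<close>

text \<open>
With a subring for \<open>R\<close> these are the polynomials over it; with an ideal, those that vanish modulo it.
\<close>

definition coeffs_in :: "'a set \<Rightarrow> 'a::comm_ring_1 poly \<Rightarrow> bool"
  where "coeffs_in R F \<longleftrightarrow> (\<forall>i. Polynomial.coeff F i \<in> R)"

definition subring_of_type :: "'a::comm_ring_1 set \<Rightarrow> bool"
  where "subring_of_type R \<longleftrightarrow> 0 \<in> R \<and> 1 \<in> R \<and> (\<forall>a\<in>R. \<forall>b\<in>R. a - b \<in> R \<and> a * b \<in> R)"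

lemma subring_of_typeD:
  assumes "subring_of_type R"
  shows "0 \<in> R" "1 \<in> R" "a \<in> R \<Longrightarrow> b \<in> R \<Longrightarrow> a - b \<in> R" "a \<in> R \<Longrightarrow> b \<in> R \<Longrightarrow> a * b \<in> R"
    "a \<in> R \<Longrightarrow> b \<in> R \<Longrightarrow> a + b \<in> R" "a \<in> R \<Longrightarrow> a ^ n \<in> R"
proof -
  show *: "0 \<in> R" "1 \<in> R" "a \<in> R \<Longrightarrow> b \<in> R \<Longrightarrow> a - b \<in> R" "a \<in> R \<Longrightarrow> b \<in> R \<Longrightarrow> a * b \<in> R" for a b
    using assms by (auto simp: subring_of_type_def)
  show "a \<in> R \<Longrightarrow> b \<in> R \<Longrightarrow> a + b \<in> R" using *(3)[of a "0 - b"] *(3)[of 0 b] *(1) by simp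
  show "a ^ n \<in> R" if "a \<in> R" using that by (induction n) (auto intro: *)
qed

lemma subring_of_type_sum:
  assumes "subring_of_type R" "\<And>i. i \<in> A \<Longrightarrow> f i \<in> R"
  shows "sum f A \<in> R"
  using assms(2) by (induction A rule: infinite_finite_induct) (auto intro: subring_of_typeD[OF assms(1)])

lemma coeffs_in_intros:
  assumes R: "subring_of_type R"
  shows "coeffs_in R 0" "coeffs_in R F \<Longrightarrow> coeffs_in R G \<Longrightarrow> coeffs_in R (F + G)"
    "coeffs_in R F \<Longrightarrow> coeffs_in R G \<Longrightarrow> coeffs_in R (F - G)"
    "coeffs_in R F \<Longrightarrow> coeffs_in R G \<Longrightarrow> coeffs_in R (F * G)"
    "a \<in> R \<Longrightarrow> coeffs_in R F \<Longrightarrow> coeffs_in R (Polynomial.smult a F)"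
    "a \<in> R \<Longrightarrow> coeffs_in R (Polynomial.monom a n)"
  by (auto simp: coeffs_in_def Polynomial.coeff_mult Polynomial.coeff_monom
      intro!: subring_of_type_sum[OF R] intro: subring_of_typeD[OF R])

text \<open>
Pseudo-division by a nonconstant polynomial, with control of where the coefficients of the quotient and
the remainder lie and of the degree of the quotient.
\<close>

lemma pseudo_division_coeffs_in:
  fixes F G :: "'a::comm_ring_1 poly"
  assumes R: "subring_of_type R" and F: "coeffs_in R F" "0 < Polynomial.degree F"
    and G: "coeffs_in R G"
  shows "\<exists>k Q r. coeffs_in R Q \<and> coeffs_in R r
      \<and> Polynomial.smult (Polynomial.lead_coeff F ^ k) G = Q * F + r
      \<and> Polynomial.degree r < Polynomial.degree F \<and> (Q = 0 \<or> Polynomial.degree Q < Polynomial.degree G)"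
  using G
proof (induction "Polynomial.degree G" arbitrary: G rule: less_induct)
  case less
  let ?n = "Polynomial.degree G" and ?d = "Polynomial.degree F" and ?b = "Polynomial.lead_coeff F"
  show ?case
  proof (cases "?n < ?d")
    case True
    then show ?thesis using less.prems coeffs_in_intros(1)[OF R]
      by (intro exI[of _ 0] exI[of _ G]) auto
  next
    case False
    have bR: "?b \<in> R" and aR: "Polynomial.lead_coeff G \<in> R"
      using F less.prems by (auto simp: coeffs_in_def)
    define M where "M = Polynomial.monom (Polynomial.lead_coeff G) (?n - ?d)"
    define G' where "G' = Polynomial.smult ?b G - M * F"
    have M: "coeffs_in R M" unfolding M_def by (rule coeffs_in_intros(6)[OF R aR])
    have cG': "coeffs_in R G'" unfolding G'_def
      by (intro coeffs_in_intros[OF R] bR less.prems F M)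
    have "Polynomial.degree G' < ?n"
    proof (rule degree_lessI)
      show "G' \<noteq> 0 \<or> 0 < ?n" using False F by auto
      show "\<forall>k\<ge>?n. Polynomial.coeff G' k = 0"
      proof (intro allI impI)
        fix k assume k: "?n \<le> k"
        have "Polynomial.coeff (M * F) k = Polynomial.lead_coeff G * Polynomial.coeff F (k - (?n - ?d))"
          using k unfolding M_def by (simp add: Polynomial.coeff_monom_mult)
        moreover have "k = ?n \<or> ?d < k - (?n - ?d) \<and> ?n < k" using k False by auto
        ultimately show "Polynomial.coeff G' k = 0"
          using False unfolding G'_def by (auto simp: Polynomial.coeff_eq_0 mult.commute)
      qed
    qed
    from less.hyps[OF this cG'] obtain k Q r where Q: "coeffs_in R Q" "coeffs_in R r"
      "Polynomial.smult (?b ^ k) G' = Q * F + r" "Polynomial.degree r < ?d"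
      "Q = 0 \<or> Polynomial.degree Q < Polynomial.degree G'" by blast
    let ?Q = "Q + Polynomial.smult (?b ^ k) M"
    have "Polynomial.smult (?b ^ Suc k) G = ?Q * F + r"
    proof -
      have "Polynomial.smult (?b ^ k) G' = Polynomial.smult (?b ^ Suc k) G - Polynomial.smult (?b ^ k) M * F"
        by (simp add: G'_def Polynomial.smult_diff_right mult.commute)
      then show ?thesis using Q(3) by (simp add: algebra_simps)
    qed
    moreover have "coeffs_in R ?Q"
      by (intro coeffs_in_intros[OF R] Q M subring_of_typeD[OF R] bR)
    moreover have "Polynomial.degree ?Q < ?n"
    proof (rule Polynomial.degree_add_less)
      show "Polynomial.degree Q < ?n" using Q(5) \<open>Polynomial.degree G' < ?n\<close> False F by auto
      have "Polynomial.degree (Polynomial.smult (?b ^ k) M) \<le> ?n - ?d"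
        unfolding M_def by (meson Polynomial.degree_monom_le Polynomial.degree_smult_le order_trans)
      then show "Polynomial.degree (Polynomial.smult (?b ^ k) M) < ?n" using False F by simp
    qed
    ultimately show ?thesis using Q by blast
  qed
qed

text \<open>
If the primes \<open>p \<subseteq> q\<close> have the same contraction to \<open>R\<close> and \<open>x\<close> is algebraic over \<open>R\<close> modulo \<open>p\<close>,
then they have the same contraction to \<open>R[x]\<close>. Over the fraction field of \<open>R\<close> modulo \<open>p\<close> the minimal
relation of \<open>x\<close> generates a maximal ideal, which leaves no room for \<open>q\<close>. The proof makes this
explicit without fractions: take a relation \<open>G\<close> of least degree, an expression \<open>F(x)\<close> of least degree in
\<open>q - p\<close>, and reduce each by the other.
\<close>

lemma lift_prime_contraction_along_algebraic_element:
  fixes p q R :: "'a::comm_ring_1 set"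
  assumes R: "subring_of_type R"
    and p: "\<And>a b. a \<in> p \<Longrightarrow> b \<in> p \<Longrightarrow> a - b \<in> p" "\<And>a b. a \<in> p \<Longrightarrow> b * a \<in> p" "0 \<in> p"
      "\<And>a b. a * b \<in> p \<Longrightarrow> a \<in> p \<or> b \<in> p" "1 \<notin> p"
    and q: "\<And>a b. a \<in> q \<Longrightarrow> b \<in> q \<Longrightarrow> a - b \<in> q" "\<And>a b. a \<in> q \<Longrightarrow> b * a \<in> q"
    and pq: "p \<subseteq> q" "q \<inter> R \<subseteq> p"
    and G0: "coeffs_in R G0" "Polynomial.poly G0 x \<in> p" "\<not> coeffs_in p G0"
    and F0: "coeffs_in R F0" "Polynomial.poly F0 x \<in> q"
  shows "Polynomial.poly F0 x \<in> p"
proof (rule ccontr)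
  assume nF0: "Polynomial.poly F0 x \<notin> p"
  have p_add: "a + b \<in> p" if "a \<in> p" "b \<in> p" for a b
    using p(1)[of a "0 - b"] p(1)[of 0 b] p(3) that by simp
  have p_mono: "a - b \<notin> p" if "a \<notin> p" "b \<in> p" for a b
    using p_add[of "a - b" b] that by auto
  have p_pow: "a ^ k \<notin> p" if "a \<notin> p" for a k
    using that p(4,5) by (induction k) auto
  have eval: "Polynomial.poly r x = a ^ k * Polynomial.poly G x - Polynomial.poly Q x * Polynomial.poly F x"
    if "Polynomial.smult (a ^ k) G = Q * F + r" for a k G Q F r
    using arg_cong[OF that, of "\<lambda>h. Polynomial.poly h x"] by simp
  have drop_lead: "Polynomial.degree (F - Polynomial.monom (Polynomial.lead_coeff F) (Polynomial.degree F)) < Polynomial.degree F"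
    if "Polynomial.degree F \<noteq> 0" for F :: "'a poly"
    by (rule degree_lessI) (use that in \<open>auto simp: Polynomial.coeff_eq_0\<close>)
  have const: "Polynomial.poly F x = Polynomial.lead_coeff F" if "Polynomial.degree F = 0" for F
    using that by (metis Polynomial.degree_0_id Polynomial.poly_0 mult_zero_right add_0_right Polynomial.poly_pCons Polynomial.lead_coeff_pCons(2) degree_eq_zeroE)

  \<comment> \<open>minimality forces the leading coefficients of \<open>G\<close> and \<open>F\<close> out of \<open>p\<close>, since otherwise the leading
    term could be dropped\<close>
  define relG where "relG G \<longleftrightarrow> coeffs_in R G \<and> Polynomial.poly G x \<in> p \<and> \<not> coeffs_in p G" for G
  obtain G where G: "relG G" "\<And>G'. relG G' \<Longrightarrow> Polynomial.degree G \<le> Polynomial.degree G'"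
    using ex_has_least_nat[of relG G0 Polynomial.degree] G0 unfolding relG_def by blast
  have G': "coeffs_in R G" "Polynomial.poly G x \<in> p" "\<not> coeffs_in p G" using G(1) by (auto simp: relG_def)
  define relF where "relF F \<longleftrightarrow> coeffs_in R F \<and> Polynomial.poly F x \<in> q \<and> Polynomial.poly F x \<notin> p" for F
  obtain F where F: "relF F" "\<And>F'. relF F' \<Longrightarrow> Polynomial.degree F \<le> Polynomial.degree F'"
    using ex_has_least_nat[of relF F0 Polynomial.degree] F0 nF0 unfolding relF_def by blast
  have F': "coeffs_in R F" "Polynomial.poly F x \<in> q" "Polynomial.poly F x \<notin> p" using F(1) by (auto simp: relF_def)
  have lR: "Polynomial.lead_coeff G \<in> R" "Polynomial.lead_coeff F \<in> R"
    using F'(1) G'(1) by (auto simp: coeffs_in_def)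
  let ?tail = "\<lambda>F. F - Polynomial.monom (Polynomial.lead_coeff F) (Polynomial.degree F)"
  have lG: "Polynomial.lead_coeff G \<notin> p"
  proof
    assume a: "Polynomial.lead_coeff G \<in> p"
    have ne: "Polynomial.degree G \<noteq> 0"
    proof
      assume z: "Polynomial.degree G = 0"
      have "Polynomial.coeff G i \<in> p" for i
        using a p(3) z by (cases i) (auto simp: Polynomial.coeff_eq_0)
      then show False using G'(3) by (simp add: coeffs_in_def)
    qed
    have "relG (?tail G)" unfolding relG_def
    proof (intro conjI)
      show "coeffs_in R (?tail G)" by (intro coeffs_in_intros[OF R] G' lR)
      have "Polynomial.lead_coeff G * x ^ Polynomial.degree G \<in> p" using p(2)[OF a, of "x ^ Polynomial.degree G"] by (simp add: mult.commute)
      then show "Polynomial.poly (?tail G) x \<in> p" using p(1)[OF G'(2)] by (simp add: Polynomial.poly_monom)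
      show "\<not> coeffs_in p (?tail G)"
      proof
        assume *: "coeffs_in p (?tail G)"
        have "Polynomial.coeff G i \<in> p" for i
        proof (cases "i = Polynomial.degree G")
          case False
          then show ?thesis using *[unfolded coeffs_in_def, rule_format, of i] by (simp add: Polynomial.coeff_monom)
        qed (use a in simp)
        then show False using G'(3) by (simp add: coeffs_in_def)
      qed
    qed
    from G(2)[OF this] drop_lead[OF ne] show False by simp
  qed
  have dG: "Polynomial.degree G \<noteq> 0"
    using const[of G] lG G'(2) by metis
  have dF: "Polynomial.degree F \<noteq> 0"
  proof
    assume "Polynomial.degree F = 0"
    from const[OF this] have "Polynomial.poly F x \<in> R" using lR(2) by metis
    then show False using F' pq(2) by blast
  qed
  have lF: "Polynomial.lead_coeff F \<notin> p"
  proof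
    assume a: "Polynomial.lead_coeff F \<in> p"
    then have *: "Polynomial.lead_coeff F * x ^ Polynomial.degree F \<in> p" using p(2)[OF a, of "x ^ Polynomial.degree F"] by (simp add: mult.commute)
    have "relF (?tail F)" unfolding relF_def
    proof (intro conjI)
      show "coeffs_in R (?tail F)" by (intro coeffs_in_intros[OF R] F' lR)
      show "Polynomial.poly (?tail F) x \<in> q" using q(1)[OF F'(2)] * pq(1) by (auto simp: Polynomial.poly_monom)
      show "Polynomial.poly (?tail F) x \<notin> p" using p_mono[OF F'(3) *] by (simp add: Polynomial.poly_monom)
    qed
    from F(2)[OF this] drop_lead[OF dF] show False by simp
  qed

  \<comment> \<open>reducing \<open>F\<close> by \<open>G\<close> shows that \<open>F\<close> has smaller degree\<close>
  obtain k Q r where 1: "coeffs_in R Q" "coeffs_in R r"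
      "Polynomial.smult (Polynomial.lead_coeff G ^ k) F = Q * G + r" "Polynomial.degree r < Polynomial.degree G"
    using pseudo_division_coeffs_in[OF R G'(1) _ F'(1)] dG by blast
  have "relF r" unfolding relF_def eval[OF 1(3)]
  proof (intro conjI 1)
    have QG: "Polynomial.poly Q x * Polynomial.poly G x \<in> p" using p(2)[OF G'(2)] .
    then show "Polynomial.lead_coeff G ^ k * Polynomial.poly F x - Polynomial.poly Q x * Polynomial.poly G x \<in> q"
      using q(1)[OF q(2)[OF F'(2)]] pq(1) by blast
    show "Polynomial.lead_coeff G ^ k * Polynomial.poly F x - Polynomial.poly Q x * Polynomial.poly G x \<notin> p"
      by (rule p_mono[OF _ QG]) (use p(4) p_pow[OF lG] F'(3) in blast)
  qed
  with F(2) 1(4) have FG: "Polynomial.degree F < Polynomial.degree G" using le_less_trans by blast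
  \<comment> \<open>in the reduction of \<open>G\<close> by \<open>F\<close> the quotient and the remainder are both relations of smaller
    degree, so their coefficients lie in \<open>p\<close>, and then so do those of \<open>G\<close>\<close>
  obtain k Q r where 2: "coeffs_in R Q" "coeffs_in R r"
      "Polynomial.smult (Polynomial.lead_coeff F ^ k) G = Q * F + r" "Polynomial.degree r < Polynomial.degree F"
      "Q = 0 \<or> Polynomial.degree Q < Polynomial.degree G"
    using pseudo_division_coeffs_in[OF R F'(1) _ G'(1)] dF by blast
  have rx: "Polynomial.poly r x \<in> p"
  proof (rule ccontr)
    assume "Polynomial.poly r x \<notin> p"
    moreover have "Polynomial.poly r x \<in> q" unfolding eval[OF 2(3)]
      using q(1)[OF q(2) q(2)[OF F'(2)]] pq(1) G'(2) by blast
    ultimately have "relF r" using 2(2) by (simp add: relF_def)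
    then show False using F(2) 2(4) not_le by blast
  qed
  then have "Polynomial.lead_coeff F ^ k * Polynomial.poly G x - Polynomial.poly r x \<in> p"
    using p(1,2) G'(2) by blast
  then have "Polynomial.poly Q x * Polynomial.poly F x \<in> p" by (simp add: eval[OF 2(3)])
  then have Qx: "Polynomial.poly Q x \<in> p" using p(4) F'(3) by blast
  have Qp: "coeffs_in p Q"
  proof (cases "Q = 0")
    case True then show ?thesis using p(3) by (simp add: coeffs_in_def)
  next
    case False
    then have "\<not> relG Q" using G(2)[of Q] 2(5) by auto
    then show ?thesis using 2(1) Qx by (simp add: relG_def)
  qed
  have "\<not> relG r" using G(2)[of r] 2(4) FG by auto
  then have rp: "coeffs_in p r" using 2(2) rx by (simp add: relG_def)
  have "Polynomial.coeff G i \<in> p" for i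
  proof -
    have "Polynomial.lead_coeff F ^ k * Polynomial.coeff G i = Polynomial.coeff (Q * F + r) i"
      by (simp flip: 2(3))
    also have "\<dots> \<in> p"
    proof -
      have "(\<Sum>j\<in>S. Polynomial.coeff Q j * Polynomial.coeff F (i - j)) \<in> p" for S
        using Qp p(2,3) by (induction S rule: infinite_finite_induct)
          (auto simp: coeffs_in_def mult.commute[of "Polynomial.coeff Q _"] intro!: p_add)
      then show ?thesis using rp by (auto simp: Polynomial.coeff_mult coeffs_in_def intro!: p_add)
    qed
    finally show ?thesis using p(4) p_pow[OF lF] by blast
  qed
  then show False using G'(3) by (simp add: coeffs_in_def)
qed

section \<open>Codimension of a monomial ideal\<close>

definition var :: "'x \<Rightarrow> ('x, 'k::field) mpoly"
  where "var x = monomial (Poly_Mapping.single x 1)"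

text \<open>
The polynomials in the variables in \<open>U\<close> only. Such a \<open>U\<close> is independent modulo a prime if this subring
meets the prime only in \<open>0\<close>.
\<close>

definition polys_in :: "'x set \<Rightarrow> ('x, 'k::field) mpoly set"
  where "polys_in U = {f. \<forall>m\<in>Poly_Mapping.keys f. Poly_Mapping.keys m \<subseteq> U}"

text \<open>
The ideal generated by the variables in \<open>T\<close>, described by its monomials.
\<close>

definition var_ideal :: "'x set \<Rightarrow> ('x, 'k::field) mpoly set"
  where "var_ideal T = {f. \<forall>m\<in>Poly_Mapping.keys f. Poly_Mapping.keys m \<inter> T \<noteq> {}}"

lemma keys_add_expo: "Poly_Mapping.keys (a + b) = Poly_Mapping.keys a \<union> Poly_Mapping.keys b"
  for a b :: "'x expo"
  by (auto simp: in_keys_iff lookup_add)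

lemma subring_polys_in: "subring_of_type (polys_in U :: ('x, 'k::field) mpoly set)"
  unfolding subring_of_type_def
proof (intro conjI ballI)
  fix f g :: "('x, 'k) mpoly" assume f: "f \<in> polys_in U" and g: "g \<in> polys_in U"
  show "f - g \<in> polys_in U" using f g keys_diff[of f g] unfolding polys_in_def by blast
  show "f * g \<in> polys_in U" using f g keys_mult[of f g] unfolding polys_in_def
    by (fastforce simp: keys_add_expo)
qed (auto simp: polys_in_def)

lemma monomial_power: "monomial (Poly_Mapping.single x n) = (var x) ^ n"
proof (induction n)
  case (Suc n)
  have "Poly_Mapping.single x (Suc n) = Poly_Mapping.single x 1 + Poly_Mapping.single x n"
    by (simp flip: single_add)
  then show ?case using Suc by (simp add: monomial_add var_def)
qed (simp add: monomial_def)

lemma expo_split_var: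
  fixes m :: "'x expo"
  obtains m0 where "m = m0 + Poly_Mapping.single j (poly_mapping.lookup m j)"
    "Poly_Mapping.keys m0 = Poly_Mapping.keys m - {j}"
proof (rule that)
  let ?m0 = "m - Poly_Mapping.single j (poly_mapping.lookup m j)"
  show "m = ?m0 + Poly_Mapping.single j (poly_mapping.lookup m j)"
    by (rule poly_mapping_eqI) (auto simp: lookup_add lookup_minus lookup_single when_def)
  show "Poly_Mapping.keys ?m0 = Poly_Mapping.keys m - {j}"
    by (auto simp: in_keys_iff lookup_minus lookup_single when_def split: if_splits)
qed

text \<open>
Adjoining a variable is thereby a case of adjoining one element \<open>x\<close> to a subring \<open>R\<close>.
\<close>

lemma polys_in_insert_eval:
  fixes h :: "('x, 'k::field) mpoly"
  assumes "h \<in> polys_in (insert j V)"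
  shows "\<exists>F. coeffs_in (polys_in V) F \<and> h = Polynomial.poly F (var j)"
proof -
  have *: "\<exists>F. coeffs_in (polys_in V) F \<and> Poly_Mapping.single m c = Polynomial.poly F (var j)"
    if m: "m \<in> Poly_Mapping.keys h" for m and c :: 'k
  proof -
    obtain m0 where m0: "m = m0 + Poly_Mapping.single j (poly_mapping.lookup m j)"
      "Poly_Mapping.keys m0 = Poly_Mapping.keys m - {j}" by (rule expo_split_var)
    have "Poly_Mapping.keys m0 \<subseteq> V" using assms m m0(2) by (auto simp: polys_in_def)
    then have "Poly_Mapping.single m0 c \<in> polys_in V" by (simp add: polys_in_def)
    then have "coeffs_in (polys_in V) (Polynomial.monom (Poly_Mapping.single m0 c) (poly_mapping.lookup m j))"
      by (rule coeffs_in_intros(6)[OF subring_polys_in])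
    moreover have "Poly_Mapping.single m c = Poly_Mapping.single m0 c * (var j) ^ poly_mapping.lookup m j"
      using m0(1) by (simp add: mult_single monomial_def flip: monomial_power)
    ultimately show ?thesis by (intro exI conjI) (auto simp: Polynomial.poly_monom)
  qed
  have "\<exists>F. coeffs_in (polys_in V) F
      \<and> (\<Sum>m\<in>S. Poly_Mapping.single m (poly_mapping.lookup h m)) = Polynomial.poly F (var j)"
    if "S \<subseteq> Poly_Mapping.keys h" for S
    using finite_subset[OF that finite_keys] that
  proof (induction S rule: finite_induct)
    case empty
    show ?case by (intro exI[of _ 0]) (simp add: coeffs_in_intros(1)[OF subring_polys_in])
  next
    case (insert m S)
    then obtain F where F: "coeffs_in (polys_in V) F"
      "(\<Sum>m\<in>S. Poly_Mapping.single m (poly_mapping.lookup h m)) = Polynomial.poly F (var j)" by auto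
    obtain F' where F': "coeffs_in (polys_in V) F'"
      "Poly_Mapping.single m (poly_mapping.lookup h m) = Polynomial.poly F' (var j)"
      using *[of m "poly_mapping.lookup h m"] insert.prems by auto
    show ?case
      by (intro exI[of _ "F' + F"] conjI coeffs_in_intros(2)[OF subring_polys_in] F(1) F'(1))
        (simp only: sum.insert[OF insert.hyps] F(2) F'(2) Polynomial.poly_add)
  qed
  then show ?thesis by (metis order_refl poly_mapping_eq_sum_single)
qed

lemma primeideal_S_ringD:
  fixes P :: "('x, 'k::field) mpoly set"
  assumes "primeideal P S_ring"
  shows "ideal P S_ring" "f * g \<in> P \<Longrightarrow> f \<in> P \<or> g \<in> P" "1 \<notin> P"
proof -
  interpret primeideal P "S_ring :: ('x, 'k) mpoly ring" by fact
  show I: "ideal P S_ring" by (rule is_ideal)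
  show "f * g \<in> P \<Longrightarrow> f \<in> P \<or> g \<in> P" using I_prime[of f g] by simp
  show "1 \<notin> P"
  proof
    assume "1 \<in> P"
    then have "f \<in> P" for f using ideal_S_ringD(3)[OF I, of 1 f] by simp
    then show False using I_notcarr by auto
  qed
qed

lemma primeideal_S_ringI:
  fixes P :: "('x, 'k::field) mpoly set"
  assumes "ideal P S_ring" "\<And>f g. f * g \<in> P \<Longrightarrow> f \<in> P \<or> g \<in> P" "1 \<notin> P"
  shows "primeideal P S_ring"
  by (rule primeidealI[OF assms(1) cring_S_ring]) (use assms in auto)

text \<open>
If no variable could be added to \<open>U\<close>, every variable would be algebraic modulo \<open>p\<close> over the polynomials
in \<open>U\<close>. Adjoining the variables one at a time, \<open>p\<close> and \<open>q\<close> would have the same contraction to each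
intermediate ring, and finally would be equal.
\<close>

lemma independent_extends_below:
  fixes p q :: "('x::finite, 'k::field) mpoly set"
  assumes p: "primeideal p S_ring" and q: "primeideal q S_ring" and pq: "p \<subset> q"
    and ind: "q \<inter> polys_in U \<subseteq> {0}"
  shows "\<exists>j. j \<notin> U \<and> p \<inter> polys_in (insert j U) \<subseteq> {0}"
proof (rule ccontr)
  assume neg: "\<not> ?thesis"
  note pI = primeideal_S_ringD(1)[OF p] and qI = primeideal_S_ringD(1)[OF q]
  have "W \<inter> U = {} \<longrightarrow> q \<inter> polys_in (U \<union> W) \<subseteq> p" for W :: "'x set"
  proof (induction W rule: finite_induct[OF finite])
    case 1
    then show ?case using ind ideal_S_ringD(1)[OF pI] by auto
  next
    case (2 j W)
    show ?case
    proof (intro impI subsetI)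
      assume jW: "insert j W \<inter> U = {}"
      fix f assume f: "f \<in> q \<inter> polys_in (U \<union> insert j W)"
      let ?R = "polys_in (U \<union> W) :: ('x, 'k) mpoly set"
      obtain h where h: "h \<in> p" "h \<in> polys_in (insert j U)" "h \<noteq> 0"
        using neg jW by auto
      obtain G where G: "coeffs_in (polys_in U) G" "h = Polynomial.poly G (var j)"
        using polys_in_insert_eval[OF h(2)] by blast
      obtain F where F: "coeffs_in ?R F" "f = Polynomial.poly F (var j)"
        using polys_in_insert_eval[of f j "U \<union> W"] f by auto
      have "Polynomial.poly F (var j) \<in> p"
      proof (rule lift_prime_contraction_along_algebraic_element[where R = ?R and q = q])
        show "coeffs_in ?R G" using G(1) by (auto simp: coeffs_in_def polys_in_def)
        show "\<not> coeffs_in p G"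
        proof
          assume "coeffs_in p G"
          then have "Polynomial.coeff G i = 0" for i
            using G(1) ind pq unfolding coeffs_in_def by blast
          then have "G = 0" by (simp add: Polynomial.poly_eq_iff)
          then show False using h(3) G(2) by simp
        qed
        show "q \<inter> ?R \<subseteq> p" using 2 jW by auto
        show "subring_of_type ?R" by (rule subring_polys_in)
        show "p \<subseteq> q" using pq by blast
        show "a \<in> p \<or> b \<in> p" if "a * b \<in> p" for a b using primeideal_S_ringD(2)[OF p that] .
        show "1 \<notin> p" by (rule primeideal_S_ringD(3)[OF p])
        show "coeffs_in ?R F" by (rule F(1))
        show "Polynomial.poly F (var j) \<in> q" using f F(2) by simp
        show "Polynomial.poly G (var j) \<in> p" using h(1) G(2) by simp
      qed (fact ideal_S_ringD[OF pI] ideal_S_ringD[OF qI])+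
      then show "f \<in> p" using F by simp
    qed
  qed
  from this[of "- U"] have "q \<subseteq> p" by (simp add: polys_in_def)
  then show False using pq by blast
qed

text \<open>
Each step down the chain adds a variable to an independent set.
\<close>

lemma prime_chain_length_le:
  fixes p :: "nat \<Rightarrow> ('x::finite, 'k::field) mpoly set"
  assumes "\<forall>i\<le>h. primeideal (p i) S_ring" "\<forall>i<h. p i \<subset> p (Suc i)" "p h \<inter> polys_in V \<subseteq> {0}"
  shows "h + card V \<le> card (UNIV :: 'x set)"
proof -
  have "i \<le> h \<Longrightarrow> \<exists>U. i + card V \<le> card U \<and> p (h - i) \<inter> polys_in U \<subseteq> {0}" for i
  proof (induction i)
    case 0
    show ?case by (rule exI[of _ V]) (use assms(3) in simp)
  next
    case (Suc i)
    then obtain U where U: "i + card V \<le> card U" "p (h - i) \<inter> polys_in U \<subseteq> {0}" by auto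
    have "p (h - Suc i) \<subset> p (h - i)" using assms(2)[rule_format, of "h - Suc i"] Suc.prems
      by (simp add: Suc_diff_Suc)
    then obtain j where j: "j \<notin> U" "p (h - Suc i) \<inter> polys_in (insert j U) \<subseteq> {0}"
      using independent_extends_below[OF _ _ _ U(2), of "p (h - Suc i)"] assms(1) by auto
    have "Suc i + card V \<le> card (insert j U)" using j(1) U(1) by simp
    then show ?case using j(2) by blast
  qed
  from this[of h] obtain U :: "'x set" where "h + card V \<le> card U" by auto
  also have "card U \<le> card (UNIV :: 'x set)" by (rule card_mono) auto
  finally show ?thesis .
qed

lemma ideal_var_ideal: "ideal (var_ideal T :: ('x, 'k::field) mpoly set) S_ring"
proof (rule ideal_S_ringI)
  fix f g :: "('x, 'k) mpoly"
  assume g: "g \<in> var_ideal T"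
  show "f + g \<in> var_ideal T" if "f \<in> var_ideal T"
    using that g keys_add[of f g] unfolding var_ideal_def by blast
  show "f * g \<in> var_ideal T"
    using g keys_mult[of f g] unfolding var_ideal_def by (fastforce simp: keys_add_expo)
qed (simp add: var_ideal_def)

lemma lookup_mult_finite_sum:
  "poly_mapping.lookup (f * g) n = (\<Sum>a\<in>Poly_Mapping.keys f. \<Sum>b\<in>Poly_Mapping.keys g.
     if a + b = n then poly_mapping.lookup f a * poly_mapping.lookup g b else 0)"
proof -
  have "f * g = (\<Sum>a\<in>Poly_Mapping.keys f. \<Sum>b\<in>Poly_Mapping.keys g.
      Poly_Mapping.single (a + b) (poly_mapping.lookup f a * poly_mapping.lookup g b))"
    by (subst poly_mapping_eq_sum_single[of f], subst poly_mapping_eq_sum_single[of g])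
      (simp add: sum_product mult_single)
  then show ?thesis by (simp add: lookup_sum lookup_single when_def)
qed

text \<open>
The exponent vectors over an unordered finite set of variables inherit a monomial order from an
enumeration of the variables.
\<close>

lemma additive_injection_into_ordered:
  obtains \<phi> :: "'x::finite expo \<Rightarrow> (nat \<Rightarrow>\<^sub>0 nat)"
  where "inj \<phi>" "\<And>a b. \<phi> (a + b) = \<phi> a + \<phi> b"
proof -
  obtain idx :: "'x \<Rightarrow> nat" where idx: "inj idx"
    using finite_imp_inj_to_nat_seg[of "UNIV :: 'x set"] by auto
  define \<phi> where "\<phi> m = (\<Sum>x\<in>UNIV. Poly_Mapping.single (idx x) (poly_mapping.lookup m x))" for m :: "'x expo"
  have "poly_mapping.lookup (\<phi> m) (idx y) = poly_mapping.lookup m y" for m y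
    using idx by (simp add: \<phi>_def lookup_sum lookup_single when_def inj_eq)
  then have "inj \<phi>" by (metis (no_types, lifting) injI poly_mapping_eqI)
  moreover have "\<phi> (a + b) = \<phi> a + \<phi> b" for a b
    by (simp add: \<phi>_def lookup_add single_add sum.distrib)
  ultimately show ?thesis by (rule that)
qed

text \<open>
Among the monomials of \<open>f\<close> and of \<open>g\<close> without a variable from \<open>T\<close>, take the largest ones in a monomial
order. Their product occurs in \<open>f * g\<close> with nonzero coefficient, since no other pair of monomials of \<open>f\<close>
and \<open>g\<close> has the same product.
\<close>

lemma primeideal_var_ideal: "primeideal (var_ideal T :: ('x::finite, 'k::field) mpoly set) S_ring"
proof (rule primeideal_S_ringI[OF ideal_var_ideal])
  show "1 \<notin> (var_ideal T :: ('x, 'k) mpoly set)" by (simp add: var_ideal_def)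
  fix f g :: "('x, 'k) mpoly"
  assume fg: "f * g \<in> var_ideal T"
  obtain \<phi> :: "'x expo \<Rightarrow> (nat \<Rightarrow>\<^sub>0 nat)" where \<phi>: "inj \<phi>" "\<And>a b. \<phi> (a + b) = \<phi> a + \<phi> b"
    by (rule additive_injection_into_ordered) blast
  define K where "K f = {m \<in> Poly_Mapping.keys f. Poly_Mapping.keys m \<inter> T = {}}" for f :: "('x, 'k) mpoly"
  have top: "\<exists>m\<in>K f. \<forall>a\<in>K f. \<phi> a \<le> \<phi> m" if "f \<notin> var_ideal T" for f
  proof -
    have "finite (K f)" "K f \<noteq> {}" using that by (auto simp: K_def var_ideal_def)
    then have "Max (\<phi> ` K f) \<in> \<phi> ` K f" "\<forall>a\<in>K f. \<phi> a \<le> Max (\<phi> ` K f)" by auto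
    then show ?thesis by (metis imageE)
  qed
  show "f \<in> var_ideal T \<or> g \<in> var_ideal T"
  proof (rule ccontr)
    assume "\<not> ?thesis"
    then obtain m1 m2 where m1: "m1 \<in> K f" "\<forall>a\<in>K f. \<phi> a \<le> \<phi> m1"
      and m2: "m2 \<in> K g" "\<forall>b\<in>K g. \<phi> b \<le> \<phi> m2" using top by meson
    have unique: "a = m1 \<and> b = m2"
      if "a \<in> Poly_Mapping.keys f" "b \<in> Poly_Mapping.keys g" "a + b = m1 + m2" for a b
    proof -
      have "Poly_Mapping.keys a \<union> Poly_Mapping.keys b = Poly_Mapping.keys m1 \<union> Poly_Mapping.keys m2"
        using that(3) by (metis keys_add_expo)
      then have "a \<in> K f" "b \<in> K g" using that m1(1) m2(1) unfolding K_def by blast+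
      then have le: "\<phi> a \<le> \<phi> m1" "\<phi> b \<le> \<phi> m2" using m1 m2 by auto
      have eq: "\<phi> a + \<phi> b = \<phi> m1 + \<phi> m2" using that(3) \<phi>(2) by metis
      have "\<not> \<phi> a < \<phi> m1" using add_less_le_mono[OF _ le(2), of "\<phi> a" "\<phi> m1"] eq by auto
      then have "\<phi> a = \<phi> m1" using le by simp
      then have "a = m1" using \<phi>(1) by (simp add: inj_eq)
      then show ?thesis using that(3) by simp
    qed
    have "poly_mapping.lookup (f * g) (m1 + m2)
      = (\<Sum>a\<in>Poly_Mapping.keys f. \<Sum>b\<in>Poly_Mapping.keys g.
          if b = m2 then if a = m1 then poly_mapping.lookup f a * poly_mapping.lookup g b else 0 else 0)"
      unfolding lookup_mult_finite_sum by (intro sum.cong refl) (use unique in auto)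
    also have "\<dots> = poly_mapping.lookup f m1 * poly_mapping.lookup g m2"
      using m1(1) m2(1) by (simp add: K_def)
    also have "\<dots> \<noteq> 0" using m1(1) m2(1) by (simp add: K_def in_keys_iff)
    finally have "m1 + m2 \<in> Poly_Mapping.keys (f * g)" by (simp add: in_keys_iff)
    then have "Poly_Mapping.keys (m1 + m2) \<inter> T \<noteq> {}" using fg unfolding var_ideal_def by blast
    then show False using m1(1) m2(1) by (simp add: K_def keys_add_expo Int_Un_distrib2)
  qed
qed

lemma prime_height_var_ideal_le:
  "prime_height S_ring (var_ideal T :: ('x::finite, 'k::field) mpoly set) \<le> enat (card T)"
  unfolding prime_height_def
proof (rule Sup_least, clarify)
  fix h and p :: "nat \<Rightarrow> ('x, 'k) mpoly set"
  assume p: "\<forall>i\<le>h. primeideal (p i) S_ring" "\<forall>i<h. p i \<subset> p (Suc i)" and ph: "p h = var_ideal T"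
  have "p h \<inter> polys_in (- T) \<subseteq> {0}"
  proof
    fix f assume "f \<in> p h \<inter> polys_in (- T)"
    then have "Poly_Mapping.keys f = {}" unfolding ph var_ideal_def polys_in_def by blast
    then show "f \<in> {0}" by simp
  qed
  from prime_chain_length_le[OF p this] have "h + card (- T) \<le> card (UNIV :: 'x set)" .
  then show "enat h \<le> enat (card T)"
    using card_Diff_subset[of T UNIV] card_mono[of UNIV T] by (simp add: Compl_eq_Diff_UNIV)
qed

lemma monomial_mem_prime:
  fixes P :: "('x::finite, 'k::field) mpoly set"
  assumes P: "primeideal P S_ring" and "monomial m \<in> P"
  shows "\<exists>x. poly_mapping.lookup m x \<noteq> 0 \<and> var x \<in> P"
  using assms(2)
proof (induction "mdeg m" arbitrary: m rule: less_induct)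
  case less
  show ?case
  proof (cases "m = 0")
    case True
    then have "1 \<in> P" using less.prems by (simp add: monomial_def)
    then show ?thesis using primeideal_S_ringD(3)[OF P] by blast
  next
    case False
    then obtain x where x: "poly_mapping.lookup m x \<noteq> 0"
      by (metis lookup_zero poly_mapping_eqI)
    then have "\<exists>k. m = Poly_Mapping.single x 1 + k"
      unfolding expo_le_iff by (auto simp: lookup_single when_def)
    then obtain k where k: "m = Poly_Mapping.single x 1 + k" ..
    then have "var x * monomial k \<in> P" using less.prems by (simp add: var_def monomial_add)
    then consider "var x \<in> P" | "monomial k \<in> P" using primeideal_S_ringD(2)[OF P] by blast
    then show ?thesis
    proof cases
      case 2
      have "mdeg (Poly_Mapping.single x 1) \<noteq> 0" unfolding mdeg_eq_0_iff
        by (metis lookup_single_eq lookup_zero zero_neq_one)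
      then have "mdeg k < mdeg m" by (simp add: k mdeg_add)
      from less.hyps[OF this 2] show ?thesis by (auto simp: k lookup_add)
    qed (use x in blast)
  qed
qed

lemma var_ideal_subset_prime:
  fixes P :: "('x, 'k::field) mpoly set"
  assumes "ideal P S_ring" "\<And>x. x \<in> T \<Longrightarrow> var x \<in> P"
  shows "var_ideal T \<subseteq> P"
proof
  fix f :: "('x, 'k) mpoly" assume f: "f \<in> var_ideal T"
  show "f \<in> P"
  proof (rule ideal_mem_if_monomials_mem[OF assms(1)])
    fix m assume "m \<in> Poly_Mapping.keys f"
    then have "Poly_Mapping.keys m \<inter> T \<noteq> {}" using f by (simp add: var_ideal_def)
    then obtain x where x: "x \<in> T" "poly_mapping.lookup m x \<noteq> 0" by (auto simp: in_keys_iff)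
    then have "\<exists>k. m = Poly_Mapping.single x 1 + k"
      unfolding expo_le_iff by (auto simp: lookup_single when_def)
    then obtain k where "m = Poly_Mapping.single x 1 + k" ..
    then show "monomial m \<in> P" using ideal_S_ringD(4)[OF assms(1) assms(2)[OF x(1)]]
      by (simp add: monomial_add var_def)
  qed
qed

lemma var_ideal_strict_mono: "T \<subset> T' \<Longrightarrow> var_ideal T \<subset> (var_ideal T' :: ('x, 'k::field) mpoly set)"
proof
  assume "T \<subset> T'"
  then obtain x where x: "x \<in> T'" "x \<notin> T" by blast
  then have "var x \<in> (var_ideal T' :: ('x, 'k) mpoly set) - var_ideal T"
    by (simp add: var_ideal_def var_def)
  then show "var_ideal T \<noteq> (var_ideal T' :: ('x, 'k) mpoly set)" by blast
qed (auto simp: var_ideal_def)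

text \<open>
The ideals generated by initial segments of the list of variables in \<open>P\<close> form a chain; its top member
is replaced by \<open>P\<close> itself.
\<close>

lemma card_vars_le_prime_height:
  fixes P :: "('x::finite, 'k::field) mpoly set"
  assumes P: "primeideal P S_ring"
  shows "enat (card {x. var x \<in> P}) \<le> prime_height S_ring P"
proof -
  let ?T = "{x. var x \<in> P}"
  obtain xs where xs: "set xs = ?T" "distinct xs" using finite_distinct_list[of ?T] by auto
  let ?h = "card ?T"
  have len: "length xs = ?h" using xs by (metis distinct_card)
  define p where "p i = (if i < ?h then var_ideal (set (take i xs)) else P)" for i
  have take: "set (take i xs) \<subset> set (take (Suc i) xs)" if "i < ?h" for i
  proof -
    have "take (Suc i) xs = take i xs @ [xs ! i]" using that len by (simp add: take_Suc_conv_app_nth)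
    moreover from this have "distinct (take i xs @ [xs ! i])" using xs(2) by (metis distinct_take)
    ultimately show ?thesis by auto
  qed
  have "p i \<subset> p (Suc i)" if "i < ?h" for i
  proof -
    have "var_ideal (set (take (Suc i) xs)) \<subseteq> P"
      by (rule var_ideal_subset_prime[OF primeideal_S_ringD(1)[OF P]]) (use xs in \<open>auto dest: in_set_takeD\<close>)
    then show ?thesis using var_ideal_strict_mono[OF take[OF that]] that by (auto simp: p_def)
  qed
  moreover have "primeideal (p i) S_ring" for i
    by (simp add: p_def P primeideal_var_ideal)
  moreover have "p ?h = P" by (simp add: p_def)
  ultimately show ?thesis unfolding prime_height_def by (intro Sup_upper) blast
qed

lemma codim_monomial_ideal:
  fixes I :: "('x::finite, 'k::field) mpoly set"
  assumes I: "monomial_ideal I" and c: "codim S_ring I = enat c"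
  shows "(\<And>T. \<forall>g\<in>GEN I. Poly_Mapping.keys g \<inter> T \<noteq> {} \<Longrightarrow> c \<le> card T)"
    and "\<exists>T. (\<forall>g\<in>GEN I. Poly_Mapping.keys g \<inter> T \<noteq> {}) \<and> card T = c"
proof -
  show le: "c \<le> card T" if T: "\<forall>g\<in>GEN I. Poly_Mapping.keys g \<inter> T \<noteq> {}" for T
  proof -
    have "I \<subseteq> var_ideal T"
    proof
      fix f assume f: "f \<in> I"
      show "f \<in> var_ideal T" unfolding var_ideal_def
      proof safe
        fix m assume "m \<in> Poly_Mapping.keys f" and e: "Poly_Mapping.keys m \<inter> T = {}"
        then have "monomial m \<in> I" using f mem_monomial_ideal_iff_monomials[OF I] by blast
        then obtain g where "g \<in> GEN I" "\<forall>x. poly_mapping.lookup g x \<le> poly_mapping.lookup m x"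
          using monomial_mem_iff_GEN[OF I] by blast
        then obtain x where "x \<in> T" "poly_mapping.lookup m x \<noteq> 0"
          using T by (metis disjoint_iff in_keys_iff le_zero_eq)
        then show False using e by (auto simp: in_keys_iff)
      qed
    qed
    then have "codim S_ring I \<le> prime_height S_ring (var_ideal T :: ('x, 'k) mpoly set)"
      unfolding codim_def using primeideal_var_ideal by (intro Inf_lower) blast
    also have "\<dots> \<le> enat (card T)" by (rule prime_height_var_ideal_le)
    finally show ?thesis using c by simp
  qed
  show "\<exists>T. (\<forall>g\<in>GEN I. Poly_Mapping.keys g \<inter> T \<noteq> {}) \<and> card T = c"
  proof (rule ccontr)
    assume neg: "\<not> ?thesis"
    have "enat (Suc c) \<le> codim S_ring I"
      unfolding codim_def
    proof (rule Inf_greatest, clarify)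
      fix P :: "('x, 'k) mpoly set" assume P: "primeideal P S_ring" "I \<subseteq> P"
      let ?T = "{x. var x \<in> P}"
      have T: "\<forall>g\<in>GEN I. Poly_Mapping.keys g \<inter> ?T \<noteq> {}"
      proof
        fix g assume "g \<in> GEN I"
        then have "monomial g \<in> P" using P(2) by (auto simp: GEN_def)
        from monomial_mem_prime[OF P(1) this] show "Poly_Mapping.keys g \<inter> ?T \<noteq> {}"
          by (auto simp: in_keys_iff)
      qed
      then have "Suc c \<le> card ?T" using le[OF T] neg by (metis le_neq_implies_less Suc_leI)
      also have "enat (card ?T) \<le> prime_height S_ring P" by (rule card_vars_le_prime_height[OF P(1)])
      finally show "enat (Suc c) \<le> prime_height S_ring P" by simp
    qed
    then show False using c by simp
  qed
qed

section \<open>Dimensions of graded pieces\<close>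

text \<open>
The monomials outside \<open>I\<close> are linearly independent modulo \<open>I\<close>, because a polynomial lies in \<open>I\<close> only if
all its monomials do.
\<close>

lemma dimension_quotient_monomials:
  fixes I :: "('x, 'k::field) mpoly set"
  assumes I: "monomial_ideal I"
    and F: "finite F" "\<And>m. m \<in> F \<Longrightarrow> monomial m \<notin> I"
  shows "ring.dimension (S_ring Quot I) (card F)
    ((\<lambda>f. I +>\<^bsub>S_ring\<^esub> f) ` range (\<lambda>a. Poly_Mapping.single 0 a))
    ((\<lambda>f. I +>\<^bsub>S_ring\<^esub> f) ` {f. Poly_Mapping.keys f \<subseteq> F})"
proof -
  interpret I: ideal I S_ring by (rule monomial_ideal_ideal[OF I])
  interpret Q: ring "S_ring Quot I" by (rule I.quotient_is_ring)
  let ?q = "\<lambda>f. I +>\<^bsub>S_ring\<^esub> f"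
  let ?K = "?q ` range (\<lambda>a. Poly_Mapping.single 0 a)"
  have hom: "?q (f * g) = ?q f \<otimes>\<^bsub>S_ring Quot I\<^esub> ?q g" "?q (f + g) = ?q f \<oplus>\<^bsub>S_ring Quot I\<^esub> ?q g"
    "?q f \<in> carrier (S_ring Quot I)" for f g
    using ring_hom_memE[OF I.rcos_ring_hom] by auto
  have q_eq: "?q f = ?q g \<longleftrightarrow> f - g \<in> I" for f g
    using I.quotient_eq_iff_same_a_r_cos[OF I.ideal_axioms, of f g] by (simp add: a_minus_def)
  have zero: "?q 0 = \<zero>\<^bsub>S_ring Quot I\<^esub>"
    using I.a_rcos_zero[OF I.ideal_axioms, of 0] ideal_S_ringD(1)[OF I.ideal_axioms]
    by (simp add: FactRing_def)
  show ?thesis using F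
  proof (induction F rule: finite_induct)
    case empty
    have "{f. Poly_Mapping.keys f \<subseteq> {}} = {0 :: ('x, 'k) mpoly}" by auto
    then show ?case using Q.zero_dim[of ?K] by (simp add: zero)
  next
    case (insert m F)
    let ?E = "{f :: ('x, 'k) mpoly. Poly_Mapping.keys f \<subseteq> F}"
    have "?q (monomial m) \<notin> ?q ` ?E"
    proof
      assume "?q (monomial m) \<in> ?q ` ?E"
      then obtain f where f: "Poly_Mapping.keys f \<subseteq> F" "?q (monomial m) = ?q f" by blast
      then have fI: "monomial m - f \<in> I" by (simp only: q_eq)
      have "poly_mapping.lookup f m = 0" using f(1) insert.hyps by (auto simp: in_keys_iff)
      then have "m \<in> Poly_Mapping.keys (monomial m - f)"
        by (simp add: in_keys_iff lookup_minus monomial_def)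
      then have "monomial m \<in> I" using fI mem_monomial_ideal_iff_monomials[OF I] by blast
      then show False using insert.prems by blast
    qed
    with insert.IH insert.prems have "Q.dimension (Suc (card F)) ?K (Q.line_extension ?K (?q (monomial m)) (?q ` ?E))"
      by (intro Q.Suc_dim hom(3)) auto
    moreover have "Q.line_extension ?K (?q (monomial m)) (?q ` ?E) = ?q ` {f. Poly_Mapping.keys f \<subseteq> insert m F}"
    proof -
      have "Q.line_extension ?K (?q (monomial m)) (?q ` ?E)
        = {?q (Poly_Mapping.single m c + e) | c e. e \<in> ?E}"
      proof (intro Set.set_eqI iffI)
        fix u assume "u \<in> Q.line_extension ?K (?q (monomial m)) (?q ` ?E)"
        then obtain c e where "e \<in> ?E"
          "u = ?q (Poly_Mapping.single 0 c) \<otimes>\<^bsub>S_ring Quot I\<^esub> ?q (monomial m) \<oplus>\<^bsub>S_ring Quot I\<^esub> ?q e"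
          unfolding Q.line_extension_mem_iff by blast
        moreover from this(2) have "u = ?q (Poly_Mapping.single m c + e)"
          unfolding hom(1,2)[symmetric] by (simp add: monomial_def mult_single)
        ultimately show "u \<in> {?q (Poly_Mapping.single m c + e) | c e. e \<in> ?E}" by blast
      next
        fix u assume "u \<in> {?q (Poly_Mapping.single m c + e) | c e. e \<in> ?E}"
        then obtain c e where e: "e \<in> ?E" "u = ?q (Poly_Mapping.single m c + e)" by blast
        then have "u = ?q (Poly_Mapping.single 0 c) \<otimes>\<^bsub>S_ring Quot I\<^esub> ?q (monomial m) \<oplus>\<^bsub>S_ring Quot I\<^esub> ?q e"
          unfolding hom(1,2)[symmetric] by (simp add: monomial_def mult_single)
        then show "u \<in> Q.line_extension ?K (?q (monomial m)) (?q ` ?E)"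
          unfolding Q.line_extension_mem_iff using e(1) by blast
      qed
      also have "\<dots> = ?q ` {Poly_Mapping.single m c + e | c e. e \<in> ?E}" by blast
      also have "{Poly_Mapping.single m c + e | c e. e \<in> ?E} = {f. Poly_Mapping.keys f \<subseteq> insert m F}"
      proof (intro Set.set_eqI iffI)
        fix f assume "f \<in> {Poly_Mapping.single m c + e | c e. e \<in> ?E}"
        then obtain c e where "f = Poly_Mapping.single m c + e" "Poly_Mapping.keys e \<subseteq> F" by blast
        then show "f \<in> {f. Poly_Mapping.keys f \<subseteq> insert m F}"
          using keys_add[of "Poly_Mapping.single m c" e] by (auto split: if_splits)
      next
        fix f :: "('x, 'k) mpoly"
        assume "f \<in> {f. Poly_Mapping.keys f \<subseteq> insert m F}"
        then have f: "Poly_Mapping.keys f \<subseteq> insert m F" by simp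
        let ?c = "poly_mapping.lookup f m"
        have "poly_mapping.lookup (f - Poly_Mapping.single m ?c) n \<noteq> 0 \<Longrightarrow> n \<in> F" for n
          using f by (cases "n = m") (auto simp: lookup_minus lookup_single in_keys_iff)
        then have "f - Poly_Mapping.single m ?c \<in> ?E" by (auto simp: in_keys_iff)
        moreover have "f = Poly_Mapping.single m ?c + (f - Poly_Mapping.single m ?c)" by simp
        ultimately show "f \<in> {Poly_Mapping.single m c + e | c e. e \<in> ?E}" by blast
      qed
      finally show ?thesis .
    qed
    ultimately show ?case using insert.hyps by simp
  qed
qed

text \<open>
The ground field maps homomorphically, hence injectively, into the nonzero ring \<open>S/I\<close>.
\<close>

lemma subfield_constants_quotient:
  fixes I :: "('x, 'k::field) mpoly set"
  assumes I: "ideal I S_ring" "1 \<notin> I"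
  shows "subfield ((\<lambda>f. I +>\<^bsub>S_ring\<^esub> f) ` range (\<lambda>a. Poly_Mapping.single 0 a)) (S_ring Quot I)"
proof -
  interpret I: ideal I S_ring by (rule I)
  let ?k = "ring_of_type_algebra :: 'k ring"
  have k: "carrier ?k = UNIV" by (simp add: ring_of_type_algebra_def)
  interpret k: field ?k by (rule field_from_type_algebra)
  have "(\<lambda>a. Poly_Mapping.single 0 a) \<in> ring_hom ?k (S_ring :: ('x, 'k) mpoly ring)"
    by (rule ring_hom_memI) (auto simp: ring_of_type_algebra_def single_add mult_single)
  from ring_hom_trans[OF this I.rcos_ring_hom]
  have "ring_hom_ring ?k (S_ring Quot I) ((\<lambda>f. I +>\<^bsub>S_ring\<^esub> f) \<circ> (\<lambda>a. Poly_Mapping.single 0 a))"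
    by (intro ring_hom_ringI2 k.ring_axioms I.quotient_is_ring)
  then interpret h: ring_hom_ring ?k "S_ring Quot I" "(\<lambda>f. I +>\<^bsub>S_ring\<^esub> f) \<circ> (\<lambda>a. Poly_Mapping.single 0 a)" .
  have "I +>\<^bsub>S_ring\<^esub> 1 \<noteq> I"
    using I(2) I.a_rcos_self[of 1] by auto
  then have "\<one>\<^bsub>S_ring Quot I\<^esub> \<noteq> \<zero>\<^bsub>S_ring Quot I\<^esub>" by (simp add: FactRing_def)
  from h.img_is_subfield(2)[OF k.carrier_is_subfield this] show ?thesis
    by (simp add: k image_comp)
qed

lemma quot_dim_eq_card:
  fixes I :: "('x, 'k::field) mpoly set"
  assumes I: "monomial_ideal I" "I \<noteq> carrier S_ring"
    and fin: "finite {m \<in> M. monomial m \<notin> I}"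
  shows "quot_dim I {f. Poly_Mapping.keys f \<subseteq> M} = card {m \<in> M. monomial m \<notin> I}"
proof -
  let ?F = "{m \<in> M. monomial m \<notin> I}"
  let ?q = "\<lambda>f. I +>\<^bsub>S_ring\<^esub> f"
  note ideal = monomial_ideal_ideal[OF I(1)]
  interpret I: ideal I S_ring by (rule ideal)
  interpret Q: ring "S_ring Quot I" by (rule I.quotient_is_ring)
  have "1 \<notin> I"
  proof
    assume "1 \<in> I"
    then have "f \<in> I" for f using ideal_S_ringD(3)[OF ideal, of 1 f] by simp
    then show False using I(2) by auto
  qed
  have "?q ` {f. Poly_Mapping.keys f \<subseteq> M} = ?q ` {f. Poly_Mapping.keys f \<subseteq> ?F}"
  proof
    show "?q ` {f. Poly_Mapping.keys f \<subseteq> M} \<subseteq> ?q ` {f. Poly_Mapping.keys f \<subseteq> ?F}"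
    proof safe
      fix f :: "('x, 'k) mpoly" assume f: "Poly_Mapping.keys f \<subseteq> M"
      define g where "g = (\<Sum>m\<in>Poly_Mapping.keys f \<inter> ?F. Poly_Mapping.single m (poly_mapping.lookup f m))"
      have g: "poly_mapping.lookup g n = (if n \<in> ?F then poly_mapping.lookup f n else 0)" for n
        by (auto simp: g_def lookup_sum lookup_single when_def in_keys_iff)
      have "f - g \<in> I"
      proof (rule ideal_mem_if_monomials_mem[OF ideal])
        fix n assume "n \<in> Poly_Mapping.keys (f - g)"
        then have "n \<in> Poly_Mapping.keys f" "n \<notin> ?F" by (auto simp: in_keys_iff lookup_minus g split: if_splits)
        then show "monomial n \<in> I" using f by blast
      qed
      then have "?q f = ?q g"
        using I.quotient_eq_iff_same_a_r_cos[OF ideal, of f g] by (simp add: a_minus_def)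
      moreover have "Poly_Mapping.keys g \<subseteq> ?F" by (auto simp: in_keys_iff g split: if_splits)
      ultimately show "?q f \<in> ?q ` {f. Poly_Mapping.keys f \<subseteq> ?F}" by blast
    qed
  qed auto
  moreover have "ring.dimension (S_ring Quot I) (card ?F)
    (?q ` range (\<lambda>a. Poly_Mapping.single 0 a)) (?q ` {f. Poly_Mapping.keys f \<subseteq> ?F})"
    by (rule dimension_quotient_monomials[OF I(1) fin]) simp
  ultimately show ?thesis
    unfolding quot_dim_def using Q.dimI[OF subfield_constants_quotient[OF ideal \<open>1 \<notin> I\<close>]]
    by (simp add: over_def)
qed

section \<open>Counting exponent vectors below a staircase\<close>

definition weak_compositions :: "'x::finite set \<Rightarrow> nat \<Rightarrow> ('x \<Rightarrow> nat) set"
  where "weak_compositions Z e = {b. (\<forall>x. x \<notin> Z \<longrightarrow> b x = 0) \<and> sum b UNIV = e}"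

lemma finite_sum_eq: "finite {b :: 'x::finite \<Rightarrow> nat. sum b UNIV = e}"
proof (rule finite_subset)
  show "{b :: 'x \<Rightarrow> nat. sum b UNIV = e} \<subseteq> {b. \<forall>x. (x \<in> UNIV \<longrightarrow> b x \<in> {..e}) \<and> (x \<notin> UNIV \<longrightarrow> b x = 0)}"
    by (auto intro: member_le_sum)
  show "finite {b :: 'x \<Rightarrow> nat. \<forall>x. (x \<in> UNIV \<longrightarrow> b x \<in> {..e}) \<and> (x \<notin> UNIV \<longrightarrow> b x = 0)}"
    by (rule finite_set_of_finite_funs) auto
qed

lemma finite_weak_compositions: "finite (weak_compositions Z e)"
  by (rule finite_subset[OF _ finite_sum_eq[of e]]) (auto simp: weak_compositions_def)

lemma sum_fun_upd_Suc: "sum (b(x := Suc (b x))) UNIV = Suc (sum b UNIV)"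
  for b :: "'x::finite \<Rightarrow> nat"
  by (simp add: sum.remove[of UNIV x])

text \<open>
Pascal's rule: subtracting one at \<open>x\<close> from the vectors with a positive entry there lowers the sum by one. With truncated subtraction the formula is also right for \<open>Z = {}\<close>, where it is \<open>1\<close> for \<open>e = 0\<close>
and \<open>0\<close> otherwise.
\<close>

lemma card_weak_compositions:
  "card (weak_compositions Z e) = (e + card Z - 1) choose e"
  for Z :: "'x::finite set"
proof (induction Z arbitrary: e rule: finite_induct[OF finite])
  case 1
  have "weak_compositions {} e = (if e = 0 then {\<lambda>x :: 'x. 0} else {})"
    by (auto simp: weak_compositions_def)
  then show ?case by simp
next
  case (2 x Z)
  note IH = this
  have z: "card (insert x Z) = Suc (card Z)" using IH by simp
  show ?case
  proof (induction e)
    case 0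
    have "weak_compositions (insert x Z) 0 = {\<lambda>x. 0}" by (auto simp: weak_compositions_def)
    then show ?case by simp
  next
    case (Suc e)
    let ?up = "\<lambda>b :: 'x \<Rightarrow> nat. b(x := Suc (b x))"
    have "weak_compositions (insert x Z) (Suc e)
      = weak_compositions Z (Suc e) \<union> ?up ` weak_compositions (insert x Z) e" (is "?L = ?R")
    proof
      show "?L \<subseteq> ?R"
      proof
        fix b assume b: "b \<in> ?L"
        show "b \<in> ?R"
        proof (cases "b x")
          case 0
          then have "b y = 0" if "y \<notin> Z" for y
            using b that by (cases "y = x") (auto simp: weak_compositions_def)
          then have "b \<in> weak_compositions Z (Suc e)" using b by (simp add: weak_compositions_def)
          then show ?thesis by simp
        next
          case (Suc k)
          let ?b = "b(x := k)"
          have "?up ?b = b" using Suc by (auto simp: fun_eq_iff)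
          moreover have b_mem: "?b \<in> weak_compositions (insert x Z) e"
          proof -
            have "sum (?up ?b) UNIV = Suc (sum ?b UNIV)" by (rule sum_fun_upd_Suc)
            then have "sum ?b UNIV = e" using b unfolding \<open>?up ?b = b\<close> by (simp add: weak_compositions_def)
            then show ?thesis using b unfolding weak_compositions_def by auto
          qed
          ultimately have "b \<in> ?up ` weak_compositions (insert x Z) e" by (intro image_eqI[of b ?up ?b]) simp_all
          then show ?thesis by (rule UnI2)
        qed
      qed
      show "?R \<subseteq> ?L"
      proof (rule Un_least)
        show "weak_compositions Z (Suc e) \<subseteq> ?L" by (auto simp: weak_compositions_def)
        show "?up ` weak_compositions (insert x Z) e \<subseteq> ?L"
        proof (rule image_subsetI)
          fix b assume b: "b \<in> weak_compositions (insert x Z) e"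
          have "sum (?up b) UNIV = Suc e"
            using b by (simp only: sum_fun_upd_Suc) (simp add: weak_compositions_def)
          then show "?up b \<in> ?L" using b by (simp add: weak_compositions_def)
        qed
      qed
    qed
    moreover have "weak_compositions Z (Suc e) \<inter> ?up ` weak_compositions (insert x Z) e = {}"
      using IH(2) by (auto simp: weak_compositions_def)
    moreover have "inj ?up"
    proof (rule injI)
      fix b b' assume e: "?up b = ?up b'"
      show "b = b'"
      proof
        fix y show "b y = b' y" using fun_cong[OF e, of y] by (cases "y = x") auto
      qed
    qed
    ultimately have "card (weak_compositions (insert x Z) (Suc e))
      = card (weak_compositions Z (Suc e)) + card (weak_compositions (insert x Z) e)"
      by (simp add: card_Un_disjoint finite_weak_compositions card_image inj_on_subset)
    also have "\<dots> = ((e + card Z) choose Suc e) + ((e + card Z) choose e)"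
      using IH(3)[of "Suc e"] Suc.IH z by simp
    also have "\<dots> = (Suc e + card (insert x Z) - 1) choose Suc e" by (simp add: z add.commute)
    finally show ?case .
  qed
qed

text \<open>
The fibre over \<open>t\<close> of truncation at \<open>K\<close>. If \<open>t \<le> K\<close> it is the translate by \<open>t\<close> of the orthant spanned by
the coordinates where \<open>t\<close> has the value \<open>K\<close>.
\<close>

definition trunc_cell :: "nat \<Rightarrow> ('x \<Rightarrow> nat) \<Rightarrow> ('x \<Rightarrow> nat) set"
  where "trunc_cell K t = {a. \<forall>x. min (a x) K = t x}"

text \<open>
The exponent vectors of the monomials divisible by no monomial with exponent vector in \<open>G\<close>.
\<close>

definition standard :: "('x \<Rightarrow> nat) set \<Rightarrow> ('x \<Rightarrow> nat) set"
  where "standard G = {a. \<forall>g\<in>G. \<exists>x. a x < g x}"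

definition saturated :: "nat \<Rightarrow> ('x \<Rightarrow> nat) \<Rightarrow> 'x set"
  where "saturated K t = {x. t x = K}"

definition standard_box :: "nat \<Rightarrow> ('x \<Rightarrow> nat) set \<Rightarrow> ('x \<Rightarrow> nat) set"
  where "standard_box K G = {t \<in> standard G. \<forall>x. t x \<le> K}"

lemma finite_standard_box: "finite (standard_box K G :: ('x::finite \<Rightarrow> nat) set)"
proof (rule finite_subset)
  show "standard_box K G \<subseteq> {b. \<forall>x. (x \<in> UNIV \<longrightarrow> b x \<in> {..K}) \<and> (x \<notin> UNIV \<longrightarrow> b x = 0)}"
    by (auto simp: standard_box_def)
  show "finite {b :: 'x \<Rightarrow> nat. \<forall>x. (x \<in> UNIV \<longrightarrow> b x \<in> {..K}) \<and> (x \<notin> UNIV \<longrightarrow> b x = 0)}"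
    by (rule finite_set_of_finite_funs) auto
qed

text \<open>
If \<open>K\<close> bounds all entries of the vectors in \<open>G\<close>, truncation at \<open>K\<close> does not affect domination by a
vector in \<open>G\<close>.
\<close>

lemma standard_eq_union_cells:
  assumes "\<And>g x. g \<in> G \<Longrightarrow> g x \<le> K"
  shows "standard G = (\<Union>t\<in>standard_box K G. trunc_cell K t)"
proof (intro Set.set_eqI iffI)
  fix a assume a: "a \<in> standard G"
  have "(\<lambda>x. min (a x) K) \<in> standard_box K G"
    using a by (auto simp: standard_box_def standard_def) (meson min.strict_coboundedI1)
  then show "a \<in> (\<Union>t\<in>standard_box K G. trunc_cell K t)" by (auto simp: trunc_cell_def)
next
  fix a assume "a \<in> (\<Union>t\<in>standard_box K G. trunc_cell K t)"
  then obtain t where t: "t \<in> standard_box K G" "a \<in> trunc_cell K t" by blast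
  show "a \<in> standard G" unfolding standard_def
  proof safe
    fix g assume g: "g \<in> G"
    then obtain x where "t x < g x" using t(1) by (auto simp: standard_box_def standard_def)
    moreover have "min (a x) K = t x" using t(2) by (simp add: trunc_cell_def)
    ultimately have "a x < g x" using assms[OF g, of x] by linarith
    then show "\<exists>x. a x < g x" ..
  qed
qed

lemma card_cell_degree:
  assumes t: "\<And>x. t x \<le> K" and d: "sum t UNIV \<le> d"
  shows "card {a \<in> trunc_cell K t. sum a UNIV = d} = card (weak_compositions (saturated K t) (d - sum t UNIV))"
proof -
  let ?f = "\<lambda>b x. t x + b x"
  have "{a \<in> trunc_cell K t. sum a UNIV = d} = ?f ` weak_compositions (saturated K t) (d - sum t UNIV)" (is "?L = ?R")
  proof
    show "?L \<subseteq> ?R"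
    proof
      fix a assume a: "a \<in> ?L"
      have m: "min (a x) K = t x" for x using a by (simp add: trunc_cell_def)
      have a_eq: "a = ?f (\<lambda>x. a x - t x)"
      proof
        fix x show "a x = t x + (a x - t x)" using m[of x] by linarith
      qed
      moreover have "(\<lambda>x. a x - t x) \<in> weak_compositions (saturated K t) (d - sum t UNIV)"
      proof -
        have "a x - t x = 0" if "x \<notin> saturated K t" for x
          using m[of x] that by (auto simp: saturated_def min_def split: if_splits)
        moreover have "d = sum t UNIV + (\<Sum>x\<in>UNIV. a x - t x)"
          using a arg_cong[OF a_eq, of "\<lambda>f. sum f UNIV"] unfolding sum.distrib by simp
        ultimately show ?thesis by (simp add: weak_compositions_def)
      qed
      ultimately show "a \<in> ?R" by (rule image_eqI)
    qed
    show "?R \<subseteq> ?L"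
    proof safe
      fix b assume b: "b \<in> weak_compositions (saturated K t) (d - sum t UNIV)"
      have "min (t x + b x) K = t x" for x
        using b t[of x] by (cases "x \<in> saturated K t") (auto simp: weak_compositions_def saturated_def)
      then show "?f b \<in> trunc_cell K t" by (simp add: trunc_cell_def)
      show "sum (?f b) UNIV = d" using b d by (simp add: weak_compositions_def sum.distrib)
    qed
  qed
  moreover have "inj ?f" by (auto simp: inj_def fun_eq_iff)
  ultimately show ?thesis by (simp add: card_image inj_on_subset)
qed

text \<open>
The binomial coefficient \<open>(d - s + z - 1) choose (z - 1)\<close> as a polynomial in \<open>d\<close>, counting a cell with \<open>z\<close>
free coordinates based at a vector of degree \<open>s\<close>. A cell without free coordinates is a single vector,
which contributes nothing in large degrees.
\<close>

definition cell_poly :: "nat \<Rightarrow> nat \<Rightarrow> real poly"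
  where "cell_poly z s = (if z = 0 then 0 else
    Polynomial.smult (1 / fact (z - 1)) (\<Prod>i=1..<z. [:real i - real s, 1:]))"

lemma poly_cell_poly:
  assumes "s < d"
  shows "Polynomial.poly (cell_poly z s) (real d) = real (((d - s) + z - 1) choose (d - s))"
proof (cases z)
  case 0
  then show ?thesis using assms by (simp add: cell_poly_def)
next
  case (Suc k)
  let ?e = "d - s"
  have cp: "cell_poly z s = Polynomial.smult (1 / fact k) (\<Prod>i=1..<Suc k. [:real i - real s, 1:])"
    by (simp add: cell_poly_def Suc del: prod.op_ivl_Suc)
  have factor: "Polynomial.poly [:real i - real s, 1:] (real d) = real ?e + real i" for i
    using assms by (simp add: of_nat_diff)
  have "Polynomial.poly (cell_poly z s) (real d)
      = 1 / fact k * (\<Prod>i=1..<Suc k. Polynomial.poly [:real i - real s, 1:] (real d))"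
    by (simp only: cp Polynomial.poly_smult Polynomial.poly_prod)
  also have "\<dots> = 1 / fact k * (\<Prod>i=1..<Suc k. real ?e + real i)" by (simp only: factor)
  also have "(\<Prod>i=1..<Suc k. real ?e + real i) = (\<Prod>i<k. real ?e + 1 + real i)"
    by (rule prod.reindex_bij_witness[of _ Suc "\<lambda>i. i - 1"]) auto
  also have "\<dots> = pochhammer (real ?e + 1) k" by (simp add: pochhammer_prod atLeast0LessThan)
  also have "1 / fact k * \<dots> = (real (?e + k)) gchoose k"
    by (simp add: gbinomial_pochhammer' algebra_simps)
  also have "\<dots> = real ((?e + k) choose k)" by (simp only: binomial_gbinomial)
  also have "(?e + k) choose k = (?e + k) choose ?e"
    by (metis add_diff_cancel_right' binomial_symmetric le_add2)
  finally show ?thesis by (simp add: Suc)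
qed

lemma degree_cell_poly: "Polynomial.degree (cell_poly z s) \<le> z - 1"
proof -
  have "Polynomial.degree (\<Prod>i=1..<z. [:real i - real s, 1:]) \<le> (\<Sum>i=1..<z. Polynomial.degree [:real i - real s, 1:])"
    using Polynomial.degree_prod_sum_le[of "{1..<z}" "\<lambda>i. [:real i - real s, 1:]"] by (simp add: o_def)
  then show ?thesis by (simp add: cell_poly_def)
qed

lemma coeff_cell_poly: "0 < z \<Longrightarrow> Polynomial.coeff (cell_poly z s) (z - 1) = 1 / fact (z - 1)"
proof -
  have deg: "Polynomial.degree (\<Prod>i=1..<z. [:real i - real s, 1:]) = z - 1"
    by (subst Polynomial.degree_prod_eq_sum_degree) auto
  have "Polynomial.lead_coeff (\<Prod>i=1..<z. [:real i - real s, 1:]) = 1"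
    by (subst Polynomial.lead_coeff_prod) simp
  then have "Polynomial.coeff (\<Prod>i=1..<z. [:real i - real s, 1:]) (z - 1) = 1" unfolding deg .
  then show "0 < z \<Longrightarrow> ?thesis" by (simp add: cell_poly_def)
qed

definition count_poly :: "nat \<Rightarrow> ('x::finite \<Rightarrow> nat) set \<Rightarrow> real poly"
  where "count_poly K G = (\<Sum>t\<in>standard_box K G. cell_poly (card (saturated K t)) (sum t UNIV))"

lemma eventually_card_standard_eq_count_poly:
  fixes G :: "('x::finite \<Rightarrow> nat) set"
  assumes "\<And>g x. g \<in> G \<Longrightarrow> g x \<le> K"
  shows "eventually (\<lambda>d. real (card {a \<in> standard G. sum a UNIV = d}) = Polynomial.poly (count_poly K G) (real d)) sequentially"
proof (rule eventually_sequentiallyI)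
  have union: "standard G = (\<Union>t\<in>standard_box K G. trunc_cell K t)" by (rule standard_eq_union_cells) (rule assms)
  fix d assume d: "Suc (\<Sum>t\<in>standard_box K G. sum t UNIV) \<le> d"
  have lt: "sum t UNIV < d" if "t \<in> standard_box K G" for t
    using member_le_sum[OF that _ finite_standard_box, of "\<lambda>t. sum t UNIV"] d by simp
  have "{a \<in> standard G. sum a UNIV = d} = (\<Union>t\<in>standard_box K G. {a \<in> trunc_cell K t. sum a UNIV = d})"
    using union by auto
  moreover have "finite {a \<in> trunc_cell K t. sum a UNIV = d}" for t :: "'x \<Rightarrow> nat"
    by (rule finite_subset[OF _ finite_sum_eq[of d]]) auto
  moreover have "{a \<in> trunc_cell K t. sum a UNIV = d} \<inter> {a \<in> trunc_cell K t'. sum a UNIV = d} = {}" if "t \<noteq> t'" for t t' :: "'x \<Rightarrow> nat"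
    using that by (auto simp: trunc_cell_def fun_eq_iff)
  ultimately have "card {a \<in> standard G. sum a UNIV = d} = (\<Sum>t\<in>standard_box K G. card {a \<in> trunc_cell K t. sum a UNIV = d})"
    by (simp add: card_UN_disjoint finite_standard_box)
  also have "real \<dots> = (\<Sum>t\<in>standard_box K G. Polynomial.poly (cell_poly (card (saturated K t)) (sum t UNIV)) (real d))"
    unfolding of_nat_sum
  proof (rule sum.cong)
    fix t assume t: "t \<in> standard_box K G"
    then show "real (card {a \<in> trunc_cell K t. sum a UNIV = d})
      = Polynomial.poly (cell_poly (card (saturated K t)) (sum t UNIV)) (real d)"
      using lt[OF t] by (subst card_cell_degree) (auto simp: standard_box_def card_weak_compositions poly_cell_poly)
  qed simp
  finally show "real (card {a \<in> standard G. sum a UNIV = d}) = Polynomial.poly (count_poly K G) (real d)"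
    by (simp add: count_poly_def Polynomial.poly_sum)
qed

lemma poly_eq_if_eventually_eq:
  fixes p q :: "real poly"
  assumes "eventually (\<lambda>d. Polynomial.poly p (real d) = Polynomial.poly q (real d)) sequentially"
  shows "p = q"
proof (rule ccontr)
  assume "p \<noteq> q"
  then have fin: "finite {x. Polynomial.poly (p - q) x = 0}" by (intro Polynomial.poly_roots_finite) simp
  obtain N where N: "\<And>d. N \<le> d \<Longrightarrow> Polynomial.poly p (real d) = Polynomial.poly q (real d)"
    using assms unfolding eventually_sequentially by blast
  have "real ` {N..} \<subseteq> {x. Polynomial.poly (p - q) x = 0}" using N by auto
  then have "finite (real ` {N..})" using fin finite_subset by blast
  then have "finite {N..}" by (rule finite_imageD) (simp add: inj_on_def)
  then show False using infinite_Ici[of N] by simp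
qed

text \<open>
A cell with \<open>z\<close> free coordinates contributes a polynomial of degree \<open>z - 1\<close> with leading coefficient
\<open>1 / (z - 1)!\<close>. The top contributions are all positive and cannot cancel.
\<close>

lemma count_poly_leading:
  fixes G :: "('x::finite \<Rightarrow> nat) set"
  assumes "\<And>t. t \<in> standard_box K G \<Longrightarrow> card (saturated K t) \<le> Suc k"
    and "\<exists>t\<in>standard_box K G. card (saturated K t) = Suc k"
  shows "count_poly K G \<noteq> 0" "Polynomial.degree (count_poly K G) = k"
    "fact k * Polynomial.lead_coeff (count_poly K G) = real (card {t \<in> standard_box K G. card (saturated K t) = Suc k})"
proof -
  let ?F = "standard_box K G"
  have "Polynomial.coeff (count_poly K G) k = (\<Sum>t\<in>?F. if card (saturated K t) = Suc k then 1 / fact k else 0)"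
    unfolding count_poly_def Polynomial.coeff_sum
  proof (rule sum.cong)
    fix t assume t: "t \<in> ?F"
    show "Polynomial.coeff (cell_poly (card (saturated K t)) (sum t UNIV)) k = (if card (saturated K t) = Suc k then 1 / fact k else 0)"
    proof (cases "card (saturated K t) = Suc k")
      case True
      then show ?thesis using coeff_cell_poly[of "Suc k"] by simp
    next
      case False
      show ?thesis
      proof (cases "card (saturated K t)")
        case 0 then show ?thesis by (simp add: cell_poly_def)
      next
        case (Suc j)
        then have "j < k" using assms(1)[OF t] False by simp
        then show ?thesis using False degree_cell_poly[of "Suc j" "sum t UNIV"] Suc
          by (simp add: Polynomial.coeff_eq_0)
      qed
    qed
  qed simp
  also have "\<dots> = real (card {t \<in> ?F. card (saturated K t) = Suc k}) / fact k"
    by (simp add: sum.If_cases finite_standard_box Int_def)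
  finally have coeff: "Polynomial.coeff (count_poly K G) k = real (card {t \<in> ?F. card (saturated K t) = Suc k}) / fact k" .
  have "{t \<in> ?F. card (saturated K t) = Suc k} \<noteq> {}" "finite {t \<in> ?F. card (saturated K t) = Suc k}"
    using assms(2) by (auto simp: finite_standard_box)
  then have ne: "Polynomial.coeff (count_poly K G) k \<noteq> 0" unfolding coeff by simp
  then show "count_poly K G \<noteq> 0" by auto
  have "Polynomial.degree (cell_poly (card (saturated K t)) (sum t UNIV)) \<le> k" if "t \<in> ?F" for t
    using degree_cell_poly[of "card (saturated K t)" "sum t UNIV"] assms(1)[OF that] by linarith
  then have "Polynomial.degree (count_poly K G) \<le> k"
    unfolding count_poly_def by (intro Polynomial.degree_sum_le finite_standard_box) auto
  then show deg: "Polynomial.degree (count_poly K G) = k"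
    using Polynomial.le_degree[OF ne] by simp
  show "fact k * Polynomial.lead_coeff (count_poly K G) = real (card {t \<in> ?F. card (saturated K t) = Suc k})"
    unfolding deg coeff by simp
qed

text \<open>
The case of dimension zero: all cells are points and the Hilbert polynomial vanishes.
\<close>

lemma standard_eq_standard_box:
  fixes G :: "('x::finite \<Rightarrow> nat) set"
  assumes "\<And>g x. g \<in> G \<Longrightarrow> g x \<le> K" "\<And>t. t \<in> standard_box K G \<Longrightarrow> saturated K t = {}"
  shows "standard G = standard_box K G" "count_poly K G = 0"
proof -
  have "trunc_cell K t = {t}" if t: "t \<in> standard_box K G" for t
  proof -
    have lt: "t x < K" for x
      using assms(2)[OF t] t by (auto simp: saturated_def standard_box_def order.strict_iff_order)
    have "min (a x) K = t x \<longleftrightarrow> a x = t x" for a x using lt[of x] by linarith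
    then show ?thesis by (auto simp: trunc_cell_def)
  qed
  moreover have "standard G = (\<Union>t\<in>standard_box K G. trunc_cell K t)" by (rule standard_eq_union_cells) (rule assms(1))
  ultimately show "standard G = standard_box K G" by auto
  show "count_poly K G = 0" using assms(2) by (simp add: count_poly_def cell_poly_def)
qed

section \<open>Multiplicity of a monomial ideal\<close>

lemma bij_betw_standard_monomials:
  fixes I :: "('x::finite, 'k::field) mpoly set"
  assumes I: "monomial_ideal I"
  shows "bij_betw poly_mapping.lookup {m. P (poly_mapping.lookup m) \<and> monomial m \<notin> I}
    {a \<in> standard (poly_mapping.lookup ` GEN I). P a}"
proof (rule bij_betw_imageI)
  show "inj_on poly_mapping.lookup {m. P (poly_mapping.lookup m) \<and> monomial m \<notin> I}"
    by (rule inj_onI) (simp only: lookup_inject)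
  have mem: "monomial m \<notin> I \<longleftrightarrow> poly_mapping.lookup m \<in> standard (poly_mapping.lookup ` GEN I)" for m
    unfolding monomial_mem_iff_GEN[OF I] standard_def by (auto simp: not_le)
  show "poly_mapping.lookup ` {m. P (poly_mapping.lookup m) \<and> monomial m \<notin> I}
    = {a \<in> standard (poly_mapping.lookup ` GEN I). P a}" (is "?L = ?R")
  proof
    show "?L \<subseteq> ?R" unfolding mem by blast
    show "?R \<subseteq> ?L"
    proof
      fix a assume a: "a \<in> ?R"
      have "a = poly_mapping.lookup (Abs_poly_mapping a)" by simp
      moreover from this have "Abs_poly_mapping a \<in> {m. P (poly_mapping.lookup m) \<and> monomial m \<notin> I}"
        using a unfolding mem by simp
      ultimately show "a \<in> ?L" by (rule image_eqI)
    qed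
  qed
qed

lemma hilbert_fun_eq_card_standard:
  fixes I :: "('x::finite, 'k::field) mpoly set"
  assumes I: "monomial_ideal I" "I \<noteq> carrier S_ring"
  shows "hilbert_fun I d = card {a \<in> standard (poly_mapping.lookup ` GEN I). sum a UNIV = d}"
proof -
  let ?M = "{m. mdeg m = d}"
  have bij: "bij_betw poly_mapping.lookup {m \<in> ?M. monomial m \<notin> I}
      {a \<in> standard (poly_mapping.lookup ` GEN I). sum a UNIV = d}"
    using bij_betw_standard_monomials[OF I(1), of "\<lambda>a. sum a UNIV = d"] by (simp add: mdeg_def)
  have "finite {a \<in> standard (poly_mapping.lookup ` GEN I). sum a UNIV = d}"
    by (rule finite_subset[OF _ finite_sum_eq[of d]]) auto
  then have fin: "finite {m \<in> ?M. monomial m \<notin> I}" using bij_betw_finite[OF bij] by blast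
  have "{f :: ('x, 'k) mpoly. \<forall>m\<in>Poly_Mapping.keys f. mdeg m = d} = {f. Poly_Mapping.keys f \<subseteq> ?M}" by auto
  then show ?thesis
    unfolding hilbert_fun_def using quot_dim_eq_card[OF I fin] bij_betw_same_card[OF bij] by simp
qed

lemma hilbert_poly_eq_count_poly:
  fixes I :: "('x::finite, 'k::field) mpoly set"
  assumes I: "monomial_ideal I" "I \<noteq> carrier S_ring"
    and K: "\<And>g x. g \<in> GEN I \<Longrightarrow> poly_mapping.lookup g x \<le> K"
  shows "hilbert_poly I = count_poly K (poly_mapping.lookup ` GEN I)"
  unfolding hilbert_poly_def
proof (rule the_equality)
  show *: "eventually (\<lambda>d. real (hilbert_fun I d)
      = Polynomial.poly (count_poly K (poly_mapping.lookup ` GEN I)) (real d)) sequentially"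
    unfolding hilbert_fun_eq_card_standard[OF I]
    by (rule eventually_card_standard_eq_count_poly) (use K in auto)
  fix Q assume "eventually (\<lambda>d. real (hilbert_fun I d) = Polynomial.poly Q (real d)) sequentially"
  then have "eventually (\<lambda>d. Polynomial.poly Q (real d)
      = Polynomial.poly (count_poly K (poly_mapping.lookup ` GEN I)) (real d)) sequentially"
    using * by eventually_elim simp
  then show "Q = count_poly K (poly_mapping.lookup ` GEN I)" by (rule poly_eq_if_eventually_eq)
qed

text \<open>
For positive \<open>\<delta>\<close> only the cells with \<open>\<delta>\<close> free coordinates contribute to the leading term of the Hilbert
polynomial. For \<open>\<delta> = 0\<close> every cell is a point, and the length of \<open>S/I\<close> counts the points.
\<close>

lemma hs_multiplicity_eq_card:
  fixes I :: "('x::finite, 'k::field) mpoly set"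
  assumes I: "monomial_ideal I" "I \<noteq> carrier S_ring"
    and K: "\<And>g x. g \<in> GEN I \<Longrightarrow> poly_mapping.lookup g x \<le> K"
    and le: "\<And>t. t \<in> standard_box K (poly_mapping.lookup ` GEN I) \<Longrightarrow> card (saturated K t) \<le> \<delta>"
    and ex: "\<exists>t\<in>standard_box K (poly_mapping.lookup ` GEN I). card (saturated K t) = \<delta>"
  shows "hs_multiplicity I = real (card {t \<in> standard_box K (poly_mapping.lookup ` GEN I). card (saturated K t) = \<delta>})"
proof (cases \<delta>)
  case 0
  let ?G = "poly_mapping.lookup ` GEN I"
  have saturated: "saturated K t = {}" if "t \<in> standard_box K ?G" for t using le[OF that] 0 by simp
  have Kg: "g x \<le> K" if "g \<in> ?G" for g x using K that by auto
  have zero: "hilbert_poly I = 0"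
  proof -
    have "count_poly K ?G = 0" by (rule standard_eq_standard_box(2)) (rule Kg saturated, assumption)+
    moreover have "hilbert_poly I = count_poly K ?G" by (rule hilbert_poly_eq_count_poly[OF I K])
    ultimately show ?thesis by simp
  qed
  have standard: "standard ?G = standard_box K ?G" by (rule standard_eq_standard_box(1)) (rule Kg saturated, assumption)+
  have bij: "bij_betw poly_mapping.lookup {m \<in> UNIV. monomial m \<notin> I} (standard_box K ?G)"
    using bij_betw_standard_monomials[OF I(1), of "\<lambda>_. True"] by (simp add: standard)
  have "finite {m \<in> UNIV. monomial m \<notin> I}" using bij_betw_finite[OF bij] finite_standard_box by blast
  from quot_dim_eq_card[OF I this] have "quot_dim I UNIV = card (standard_box K ?G)"
    using bij_betw_same_card[OF bij] by simp
  moreover have "{t \<in> standard_box K ?G. card (saturated K t) = \<delta>} = standard_box K ?G" using saturated 0 by auto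
  ultimately show ?thesis by (simp add: hs_multiplicity_def zero)
next
  case (Suc k)
  note lead = count_poly_leading[of K "poly_mapping.lookup ` GEN I" k]
  have "hilbert_poly I = count_poly K (poly_mapping.lookup ` GEN I)"
    by (rule hilbert_poly_eq_count_poly[OF I K])
  then show ?thesis using lead le ex unfolding Suc hs_multiplicity_def by simp
qed

section \<open>Polarization and the Taylor bound\<close>

definition polarization :: "'x expo \<Rightarrow> ('x \<times> nat) set"
  where "polarization m = {(x, j). j < poly_mapping.lookup m x}"

lemma polarization_Sigma: "polarization m = Sigma UNIV (\<lambda>x. {..<poly_mapping.lookup m x})"
  by (auto simp: polarization_def)

lemma finite_polarization: "finite (polarization (m :: 'x::finite expo))"
  by (simp add: polarization_Sigma)

lemma card_polarization: "card (polarization (m :: 'x::finite expo)) = mdeg m"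
  by (simp add: polarization_Sigma mdeg_def card_SigmaI)

lemma inj_polarization: "inj polarization"
proof (rule injI)
  fix m m' :: "'x expo" assume e: "polarization m = polarization m'"
  show "m = m'"
  proof (rule poly_mapping_eqI)
    fix x
    have "j < poly_mapping.lookup m x \<longleftrightarrow> j < poly_mapping.lookup m' x" for j
      using e unfolding polarization_def by (auto simp: Set.set_eq_iff)
    then show "poly_mapping.lookup m x = poly_mapping.lookup m' x" by (metis less_irrefl linorder_neqE_nat)
  qed
qed

lemma polarization_lcm_expo:
  fixes T :: "'x::finite expo set"
  assumes "finite T"
  shows "polarization (lcm_expo T) = \<Union>(polarization ` T)"
proof -
  have "poly_mapping.lookup (lcm_expo T) x = Max (insert 0 ((\<lambda>m. poly_mapping.lookup m x) ` T))" for x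
    by (simp add: lcm_expo_def)
  then have "j < poly_mapping.lookup (lcm_expo T) x \<longleftrightarrow> (\<exists>m\<in>T. j < poly_mapping.lookup m x)" for j x
    using assms by (auto simp: Max_gr_iff)
  then show ?thesis by (auto simp: polarization_def)
qed

lemma taylor_shift_eq_max_union:
  fixes I :: "('x::finite, 'k::field) mpoly set"
  assumes fin: "finite (GEN I)"
  shows "taylor_shift I i = max_union (polarization ` GEN I) i"
proof -
  have "{mdeg (lcm_expo T) | T. T \<subseteq> GEN I \<and> finite T \<and> card T = i}
      = {card (\<Union>T) | T. T \<subseteq> polarization ` GEN I \<and> card T = i}" (is "?L = ?R")
  proof
    show "?L \<subseteq> ?R"
    proof
      fix n assume "n \<in> ?L"
      then obtain T where T: "T \<subseteq> GEN I" "finite T" "card T = i" "n = mdeg (lcm_expo T)" by blast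
      have "n = card (\<Union>(polarization ` T))"
        using T(2,4) by (simp flip: polarization_lcm_expo add: card_polarization)
      moreover have "card (polarization ` T) = i"
        using T(3) by (simp add: card_image inj_on_subset[OF inj_polarization])
      ultimately show "n \<in> ?R" using T(1) by blast
    qed
    show "?R \<subseteq> ?L"
    proof
      fix n assume "n \<in> ?R"
      then obtain T' where T': "T' \<subseteq> polarization ` GEN I" "card T' = i" "n = card (\<Union>T')" by blast
      then obtain T where T: "T \<subseteq> GEN I" "T' = polarization ` T" by (meson subset_imageE)
      then have "finite T" using fin finite_subset by blast
      then have "n = mdeg (lcm_expo T)"
        using T'(3) T(2) by (simp flip: polarization_lcm_expo add: card_polarization)
      moreover have "card T = i"
        using T'(2) T(2) by (simp add: card_image inj_on_subset[OF inj_polarization])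
      ultimately show "n \<in> ?L" using T(1) \<open>finite T\<close> by blast
    qed
  qed
  then show ?thesis by (simp add: taylor_shift_def max_union_def)
qed


text \<open>
A cell of exponent vectors outside the ideal gives a hitting set of the polarized generators: a generator
exceeds \<open>t\<close> in some coordinate \<open>x\<close>, which is then not saturated, and the pair \<open>(x, t x)\<close> lies below it.
\<close>

lemma hits_polarization_of_saturated:
  fixes A :: "'x::finite expo set"
  assumes t: "t \<in> standard_box K (poly_mapping.lookup ` A)"
    and K: "\<And>g x. g \<in> A \<Longrightarrow> poly_mapping.lookup g x \<le> K"
  shows "hits {(x, t x) | x. x \<notin> saturated K t} (polarization ` A)"
  unfolding hits_def
proof
  fix e assume "e \<in> polarization ` A"
  then obtain g where g: "g \<in> A" "e = polarization g" by blast
  then obtain x where x: "t x < poly_mapping.lookup g x" using t by (auto simp: standard_box_def standard_def)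
  then have "t x \<noteq> K" using K[OF g(1), of x] by simp
  then have "(x, t x) \<in> {(x, t x) | x. x \<notin> saturated K t} \<inter> e" using x g(2) by (simp add: saturated_def polarization_def)
  then show "{(x, t x) | x. x \<notin> saturated K t} \<inter> e \<noteq> {}" by blast
qed

theorem theorem6p6:
  fixes I :: "('x::finite, 'k::field) mpoly set"
    and \<mu> :: "nat \<Rightarrow> 'x expo" and r c :: nat
  assumes "monomial_ideal I"
    and "I \<noteq> carrier S_ring"
    and "codim S_ring I = enat c"
    and "inj_on \<mu> {1..r}"
    and "GEN I = \<mu> ` {1..r}"
    and "\<forall>i\<in>{2..r}. mdeg (\<mu> i) = 2"
  shows "hs_multiplicity I \<le> 1 / fact c * (\<Prod>i = 1..c. real (taylor_shift I i))"
proof -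
  let ?G = "poly_mapping.lookup ` GEN I" and ?H = "polarization ` GEN I"
  let ?n = "card (UNIV :: 'x set)"
  note I = assms(1,2)
  have finG: "finite (GEN I)" using assms(5) by simp
  note cov = codim_monomial_ideal[OF I(1) assms(3)]
  obtain T where T: "\<forall>g\<in>GEN I. Poly_Mapping.keys g \<inter> T \<noteq> {}" "card T = c" using cov(2) by blast
  have cn: "c \<le> ?n" using T(2) card_mono[of UNIV T] by simp
  \<comment> \<open>forgetting the second components of a hitting set leaves variables that meet all generators\<close>
  have min_hits: "c \<le> card C" if C: "finite C" "hits C ?H" for C
  proof -
    have "\<forall>g\<in>GEN I. Poly_Mapping.keys g \<inter> fst ` C \<noteq> {}"
    proof
      fix g assume "g \<in> GEN I"
      then have "C \<inter> polarization g \<noteq> {}" using C(2) unfolding hits_def by blast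
      then obtain p where "p \<in> C" "p \<in> polarization g" by blast
      then show "Poly_Mapping.keys g \<inter> fst ` C \<noteq> {}"
        by (force simp: polarization_def in_keys_iff)
    qed
    then have "c \<le> card (fst ` C)" by (rule cov(1))
    also have "\<dots> \<le> card C" using C(1) by (rule card_image_le)
    finally show ?thesis .
  qed
  \<comment> \<open>\<open>K\<close> is positive also for the zero ideal, so that a coordinate with exponent \<open>0\<close> is never saturated\<close>
  define K where "K = Suc (\<Sum>g\<in>GEN I. mdeg g)"
  have K: "poly_mapping.lookup g x \<le> K" if "g \<in> GEN I" for g x
  proof -
    have "poly_mapping.lookup g x \<le> mdeg g" unfolding mdeg_def by (rule member_le_sum) auto
    also have "\<dots> \<le> (\<Sum>g\<in>GEN I. mdeg g)" using that finG by (intro member_le_sum) auto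
    finally show ?thesis by (simp add: K_def)
  qed
  let ?C = "\<lambda>t. {(x, t x) | x. x \<notin> saturated K t}"
  have card_C: "card (?C t) = ?n - card (saturated K t)" for t :: "'x \<Rightarrow> nat"
  proof -
    have "?C t = (\<lambda>x. (x, t x)) ` (- saturated K t)" by auto
    then have "card (?C t) = card (- saturated K t)" by (simp add: card_image inj_on_def)
    then show ?thesis by (simp add: Compl_eq_Diff_UNIV card_Diff_subset)
  qed
  have saturated_le: "card (saturated K t) \<le> ?n" for t :: "'x \<Rightarrow> nat" by (rule card_mono) auto
  have finC: "finite (?C t)" for t :: "'x \<Rightarrow> nat" by (rule finite_subset[of _ "(\<lambda>x. (x, t x)) ` UNIV"]) auto
  have mult: "hs_multiplicity I = real (card {t \<in> standard_box K ?G. card (saturated K t) = ?n - c})"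
  proof (rule hs_multiplicity_eq_card[OF I K])
    fix t assume "t \<in> standard_box K ?G"
    then have "c \<le> card (?C t)" using min_hits[OF finC] hits_polarization_of_saturated[OF _ K] by blast
    then show "card (saturated K t) \<le> ?n - c" using card_C[of t] saturated_le[of t] by simp
  next
    \<comment> \<open>a cell of the expected dimension, from a smallest set \<open>T\<close> of variables meeting all generators\<close>
    define t where "t x = (if x \<in> T then 0 else K)" for x
    have "saturated K t = - T" by (auto simp: saturated_def t_def K_def)
    then have "card (saturated K t) = ?n - c" using T(2) by (simp add: Compl_eq_Diff_UNIV card_Diff_subset)
    moreover have "t \<in> standard_box K ?G"
    proof -
      have "\<exists>x. t x < poly_mapping.lookup g x" if "g \<in> GEN I" for g
      proof -
        have "Poly_Mapping.keys g \<inter> T \<noteq> {}" using T(1) that by blast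
        then obtain x where "x \<in> T" "poly_mapping.lookup g x \<noteq> 0" by (auto simp: in_keys_iff)
        then show ?thesis by (auto simp: t_def)
      qed
      then show ?thesis by (auto simp: standard_box_def standard_def t_def)
    qed
    ultimately show "\<exists>t\<in>standard_box K ?G. card (saturated K t) = ?n - c" by blast
  qed
  have finM: "finite (min_hitting ?H c)"
  proof (rule finite_subset)
    show "min_hitting ?H c \<subseteq> Pow (\<Union>?H)" using min_hitting_subset_vertices[OF min_hits] by blast
    show "finite (Pow (\<Union>?H))" using finG by (simp add: finite_polarization)
  qed
  have "card {t \<in> standard_box K ?G. card (saturated K t) = ?n - c} \<le> card (min_hitting ?H c)"
  proof (rule card_inj_on_le[OF _ _ finM])
    show "inj_on ?C {t \<in> standard_box K ?G. card (saturated K t) = ?n - c}"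
    proof (rule inj_onI)
      fix s t assume e: "?C s = ?C t"
      show "s = t"
      proof
        fix x
        have "(x, s x) \<in> ?C s \<or> s x = K" "(x, t x) \<in> ?C t \<or> t x = K" by (auto simp: saturated_def)
        moreover have "(x, s x) \<in> ?C t \<Longrightarrow> s x = t x" "(x, t x) \<in> ?C s \<Longrightarrow> s x = t x" by auto
        ultimately show "s x = t x" unfolding e by metis
      qed
    qed
    show "?C ` {t \<in> standard_box K ?G. card (saturated K t) = ?n - c} \<subseteq> min_hitting ?H c"
    proof (rule image_subsetI)
      fix t assume "t \<in> {t \<in> standard_box K ?G. card (saturated K t) = ?n - c}"
      then have t: "t \<in> standard_box K ?G" "card (saturated K t) = ?n - c" by auto
      have "hits (?C t) ?H" by (rule hits_polarization_of_saturated[OF t(1) K])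
      moreover have "card (?C t) = c" using card_C[of t] t(2) cn by simp
      ultimately show "?C t \<in> min_hitting ?H c" using finC by (simp add: min_hitting_def)
    qed
  qed
  then have "hs_multiplicity I \<le> real (card (min_hitting ?H c))" by (simp add: mult)
  moreover have "fact c * card (min_hitting ?H c) \<le> (\<Prod>i=1..c. max_union ?H i)"
  proof (rule min_hitting_bound[where B = "polarization (\<mu> 1)"])
    show "\<forall>e\<in>?H. e \<noteq> polarization (\<mu> 1) \<longrightarrow> card e = 2"
    proof (intro ballI impI)
      fix e assume e: "e \<in> ?H" "e \<noteq> polarization (\<mu> 1)"
      then obtain i where i: "i \<in> {1..r}" "e = polarization (\<mu> i)" unfolding assms(5) by blast
      then have "i \<in> {2..r}" using e(2) by (cases "i = 1") auto
      then show "card e = 2" using assms(6) i(2) by (simp add: card_polarization)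
    qed
  qed (use finG min_hits in \<open>auto simp: finite_polarization\<close>)
  then have "real (fact c * card (min_hitting ?H c)) \<le> real (\<Prod>i=1..c. max_union ?H i)"
    by (simp only: of_nat_le_iff)
  then have "fact c * real (card (min_hitting ?H c)) \<le> (\<Prod>i=1..c. real (taylor_shift I i))"
    by (simp add: taylor_shift_eq_max_union[OF finG])
  ultimately have "fact c * hs_multiplicity I \<le> (\<Prod>i=1..c. real (taylor_shift I i))"
    by (meson fact_ge_zero mult_left_mono order_trans)
  then show ?thesis by (simp add: field_simps)
qed

end
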